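(* Let $\eta>0$, $\epsilon>0$, $\beta\in(0,1)$ and $$\rho>\max\left\{\frac{\ell}{\underline d}+m,\ \frac{\ell_{\mathcal M}}{\underline d},\ \frac{2\ell}{\underline d}-m\right\}.$$ Run the proximal bundle method for $\min_{K\in\mathcal{K}}J(K)$ from the initial gain $K_0$: for $t=0,1,2,\dots$, $K_{t+1}=\texttt{ProxDescent}(K_t,\beta,\rho)$. Then all outer iterates satisfy $\{K_t\}\subset\mathcal{K}_0$, all inner iterates generated within the calls of $\texttt{ProxDescent}$ satisfy $\{L_k\}\subset\operatorname{int}(\widetilde{\mathcal{K}}_0)$, and an $(\eta,\epsilon)$-stationary point (of $J$ restricted to $\operatorname{int}(\widetilde{\mathcal K}_0)$) is obtained in at most $$\mathcal{O}\left(\max\left\{\frac{1}{\eta^4},\frac{1}{\epsilon^2}\right\}\right)$$ total iterations (counting all inner iterations over all calls of $\texttt{ProxDescent}$).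
   Context: **Problem.** Fix $A\in\mathbb{R}^{n_x\times n_x}$, $B\in\mathbb{R}^{n_x\times n_u}$, $B_w\in\mathbb{R}^{n_x\times n_w}$, $C\in\mathbb{R}^{n_y\times n_x}$ and symmetric $Q\in\mathbb{R}^{n_x\times n_x}$, $R\in\mathbb{R}^{n_u\times n_u}$. Standing assumptions: $(A,B)$ is stabilizable; $B_w$ and $C$ have full row rank; $Q,R$ are positive definite; and $\mathcal{K}:=\{K\in\mathbb{R}^{n_u\times n_y}\mid \text{all eigenvalues of }A+BKC\text{ have modulus}<1\}$ is nonempty. For $K\in\mathcal{K}$, $\omega\in[0,2\pi]$, let $\mathbf{T}_{zw}(K,\omega)=\begin{bmatrix}Q^{1/2}\\ R^{1/2}KC\end{bmatrix}(e^{j\omega}I-(A+BKC))^{-1}B_w$ and $J(K):=\max_{\omega\in[0,2\pi]}\sigma_{\max}(\mathbf{T}_{zw}(K,\omega))$. Let $J^\star=\min_{K\in\mathcal K}J(K)$. Inner products and norms on matrices are the trace inner product and Frobenius norm $\|\cdot\|_F$; $\operatorname{dist}$ is the induced distance. $\partial f(\bar x)=\{v\mid \liminf_{y\to\bar x,y\neq\bar x}(f(y)-f(\bar x)-\langle v,y-\bar x\rangle)/\|y-\bar x\|\ge0\}$ is the Fréchet subdifferential (the usual convex subdifferential for convex $f$). A function $f$ is $m$-weakly convex on a convex set $U$ if $f+\frac m2\|\cdot\|^2$ is convex on $U$. **Constants.** $K_0\in\mathcal{K}$ is a given gain with $J(K_0)>J^\star$; $\mathcal{K}_0:=\{K\in\mathcal{K}\mid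 J(K)\le J(K_0)\}$; $\widetilde{\mathcal{K}}_0:=\{K\in\mathcal{K}\mid J(K)\le 2J(K_0)\}$. $m>0$ is such that $J$ is $m$-weakly convex on any convex subset of $\widetilde{\mathcal K}_0$, and $\ell>0$ is such that $J$ is $\ell$-Lipschitz on $\widetilde{\mathcal K}_0$. $\underline d:=\min_{K\in\mathcal{K}_0}\operatorname{dist}(K,\partial\widetilde{\mathcal K}_0)$, where $\partial\widetilde{\mathcal K}_0$ is the topological boundary (one has $\underline d>0$). For $K\in\operatorname{int}(\widetilde{\mathcal K}_0)$, $\mathcal{U}_K$ denotes the largest open ball centered at $K$ contained in $\operatorname{int}(\widetilde{\mathcal K}_0)$. **Stationarity.** For $\bar K\in\operatorname{int}(\widetilde{\mathcal K}_0)$ and $\epsilon\ge0$, $$\partial_\epsilon J(\bar K)=\left\{V\;\middle|\;J(L)\ge J(\bar K)+\langle V,L-\bar K\rangle-\tfrac m2\|L-\bar K\|_F^2-\epsilon,\ \forall L\in\mathcal U_{\bar K}\right\}.$$ $\bar K$ is an $(\eta,\epsilon)$-stationary point if there is $V\in\partial_\epsilon J(\bar K)$ with $\|V\|_F\le\eta$. **Algorithm $\texttt{ProxDescent}(K_t,\beta,\rho)$** ($K_t\in\mathcal K_0$). For $k=0,1,2,\dots$: construct a convex model $J_k$ (below); compute $$L_{k+1}=\operatorname*{argmin}_{L\in\mathbb{R}^{n_u\times n_y}}J_k(L)+\frac\rho2\|L-K_t\|_F^2;$$ if $\beta(J(K_t)-J_k(L_{k+1}))\le J(K_t)-\left(J(L_{k+1})+\frac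 m2\|L_{k+1}-K_t\|_F^2\right)$, stop and return $L_{k+1}$. **Models.** $L_0=K_t$, $J_0(L)=J(L_0)+\langle G_0,L-L_0\rangle$ with $G_0\in\partial J(L_0)$. For $k\ge1$, $J_k$ is given by one of: (1) full-memory: $J_k(L)=\max_{i=0,\dots,k}\left\{J(L_i)+\frac m2\|L_i-K_t\|_F^2+\langle G_i,L-L_i\rangle\right\}$; (2) two-cut: $J_k(L)=\max\left\{J(L_k)+\frac m2\|L_k-K_t\|_F^2+\langle G_k,L-L_k\rangle,\ J_{k-1}(L_k)+\langle S_k,L-L_k\rangle\right\}$; (3) general: $J_k(L)=\max\left\{\mathcal M_k(L),\ J(L_k)+\frac m2\|L_k-K_t\|_F^2+\langle G_k,L-L_k\rangle,\ J_{k-1}(L_k)+\langle S_k,L-L_k\rangle\right\}$. Here $G_i-m(L_i-K_t)\in\partial J(L_i)$, $S_k=\rho(K_t-L_k)\in\partial J_{k-1}(L_k)$, and $\mathcal M_k$ is a possibly nonsmooth function that is $\ell_{\mathcal M}$-Lipschitz on $\widetilde{\mathcal K}_0$ ($\ell_{\mathcal M}\ge0$ a constant independent of $k$), convex on $\mathbb{R}^{n_u\times n_y}$, and satisfies $\mathcal M_k(L)\le J(L)+\frac m2\|L-K_t\|_F^2$ for all $L\in\mathcal U_{K_t}$. For models (1), (2) take $\ell_{\mathcal M}=0$. **Convention.** $\mathcal O(\cdot)$ is understood for small tolerances (e.g. $0<\eta,\epsilon\le1$), with a hidden constant independent of $\eta$ and $\epsilon$ (it may depend on the problem data, $K_0$,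 $m,\ell,\underline d,\rho,\beta$). *)

theory Defs
  imports "HOL-Analysis.Analysis"
begin

section \<open>Matrices\<close>

text \<open>
  The library norm and inner product on \<open>real^'n^'m\<close> are the Frobenius norm and the trace inner
  product.
\<close>

definition complexify :: "real^'n^'m \<Rightarrow> complex^'n^'m" where
  "complexify = map_matrix complex_of_real"

definition eigenvalue :: "complex^'n^'n \<Rightarrow> complex \<Rightarrow> bool" where
  "eigenvalue M z \<longleftrightarrow> (\<exists>v. v \<noteq> 0 \<and> M *v v = z *s v)"

definition schur_stable :: "real^'n^'n \<Rightarrow> bool" where
  "schur_stable M \<longleftrightarrow> (\<forall>z. eigenvalue (complexify M) z \<longrightarrow> cmod z < 1)"

definition stabilizable :: "real^'nx^'nx \<Rightarrow> real^'nu^'nx \<Rightarrow> bool" where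
  "stabilizable A B \<longleftrightarrow> (\<exists>F. schur_stable (A + B ** F))"

definition pos_def :: "real^'n^'n \<Rightarrow> bool" where
  "pos_def Q \<longleftrightarrow> transpose Q = Q \<and> (\<forall>x. x \<noteq> 0 \<longrightarrow> 0 < x \<bullet> (Q *v x))"

definition pos_semidef :: "real^'n^'n \<Rightarrow> bool" where
  "pos_semidef Q \<longleftrightarrow> transpose Q = Q \<and> (\<forall>x. 0 \<le> x \<bullet> (Q *v x))"

definition matrix_sqrt :: "real^'n^'n \<Rightarrow> real^'n^'n" where
  "matrix_sqrt Q = (THE S. pos_semidef S \<and> S ** S = Q)"

definition conj_transpose :: "complex^'n^'m \<Rightarrow> complex^'m^'n" where
  "conj_transpose M = map_matrix cnj (transpose M)"

text \<open>The singular values of \<open>M\<close> are the square roots of the (real, nonnegative) eigenvalues of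
  \<open>M\<^sup>*M\<close>.\<close>

definition sigma_max :: "complex^'n^'m \<Rightarrow> real" where
  "sigma_max M = Max {sqrt (Re z) | z. eigenvalue (conj_transpose M ** M) z}"

definition vstack :: "'a^'n^'p \<Rightarrow> 'a^'n^'q \<Rightarrow> 'a^'n^('p + 'q)" where
  "vstack M N = (\<chi> i. case i of Inl p \<Rightarrow> M $ p | Inr q \<Rightarrow> N $ q)"


section \<open>The output-feedback H-infinity cost\<close>

definition stabilizing_gains ::
  "real^'nx^'nx \<Rightarrow> real^'nu^'nx \<Rightarrow> real^'nx^'ny \<Rightarrow> (real^'ny^'nu) set" where
  "stabilizing_gains A B C = {K. schur_stable (A + B ** K ** C)}"

definition transfer_matrix ::
  "real^'nx^'nx \<Rightarrow> real^'nu^'nx \<Rightarrow> real^'nw^'nx \<Rightarrow> real^'nx^'ny \<Rightarrow>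
   real^'nx^'nx \<Rightarrow> real^'nu^'nu \<Rightarrow> real^'ny^'nu \<Rightarrow> real \<Rightarrow> complex^'nw^('nx + 'nu)" where
  "transfer_matrix A B Bw C Q R K \<omega> =
     complexify (vstack (matrix_sqrt Q) (matrix_sqrt R ** K ** C))
     ** matrix_inv (mat (cis \<omega>) - complexify (A + B ** K ** C))
     ** complexify Bw"

text \<open>
  Only the values on the stabilizing gains are meaningful. There the supremum is attained, since
  the transfer matrix depends continuously on the frequency.
\<close>

definition hinf_cost ::
  "real^'nx^'nx \<Rightarrow> real^'nu^'nx \<Rightarrow> real^'nw^'nx \<Rightarrow> real^'nx^'ny \<Rightarrow>
   real^'nx^'nx \<Rightarrow> real^'nu^'nu \<Rightarrow> real^'ny^'nu \<Rightarrow> real" where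
  "hinf_cost A B Bw C Q R K =
     (SUP \<omega>\<in>{0..2 * pi}. sigma_max (transfer_matrix A B Bw C Q R K \<omega>))"


section \<open>Weakly convex functions and stationarity\<close>

definition frechet_subdiff :: "('a::real_inner \<Rightarrow> real) \<Rightarrow> 'a \<Rightarrow> 'a set" where
  "frechet_subdiff f x =
     {v. 0 \<le> Liminf (at x) (\<lambda>y. ereal ((f y - f x - v \<bullet> (y - x)) / norm (y - x)))}"

definition weakly_convex_on :: "real \<Rightarrow> 'a::real_inner set \<Rightarrow> ('a \<Rightarrow> real) \<Rightarrow> bool" where
  "weakly_convex_on m U f \<longleftrightarrow> convex_on U (\<lambda>x. f x + m / 2 * (norm x)\<^sup>2)"

text \<open>The largest open ball around \<open>x\<close> inside \<open>S\<close>, provided that \<open>S\<close> is not the whole space.\<close>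

definition largest_ball :: "'a::real_inner set \<Rightarrow> 'a \<Rightarrow> 'a set" where
  "largest_ball S x = \<Union>{ball x r | r. ball x r \<subseteq> S}"

definition eps_subdiff ::
  "('a::real_inner \<Rightarrow> real) \<Rightarrow> real \<Rightarrow> 'a set \<Rightarrow> real \<Rightarrow> 'a \<Rightarrow> 'a set" where
  "eps_subdiff f m S \<epsilon> x =
     {v. \<forall>y \<in> largest_ball (interior S) x.
           f y \<ge> f x + v \<bullet> (y - x) - m / 2 * (norm (y - x))\<^sup>2 - \<epsilon>}"

definition stationary_point ::
  "('a::real_inner \<Rightarrow> real) \<Rightarrow> real \<Rightarrow> 'a set \<Rightarrow> real \<Rightarrow> real \<Rightarrow> 'a \<Rightarrow> bool" where
  "stationary_point f m S \<eta> \<epsilon> x \<longleftrightarrow>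
     x \<in> interior S \<and> (\<exists>v \<in> eps_subdiff f m S \<epsilon> x. norm v \<le> \<eta>)"


section \<open>The proximal bundle method\<close>

text \<open>
  \<open>c\<close> is the proximal centre of a call, \<open>L k\<close> its inner iterates, \<open>G k\<close> the vectors
  defining the cutting planes and \<open>M k\<close> the user-supplied part of the general model.
\<close>

datatype model_type = Full_Memory | Two_Cut | General

definition cut ::
  "('a::real_inner \<Rightarrow> real) \<Rightarrow> real \<Rightarrow> 'a \<Rightarrow> (nat \<Rightarrow> 'a) \<Rightarrow> (nat \<Rightarrow> 'a) \<Rightarrow> nat \<Rightarrow> 'a \<Rightarrow> real" where
  "cut f m c L G i x = f (L i) + m / 2 * (norm (L i - c))\<^sup>2 + G i \<bullet> (x - L i)"

text \<open>
  The aggregate slope \<open>\<rho> *\<^sub>R (c - L k)\<close> is a convex subgradient of the previous model at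
  \<open>L k\<close> because \<open>L k\<close> minimizes that model plus the proximal term.
\<close>

fun bundle_model ::
  "model_type \<Rightarrow> ('a::real_inner \<Rightarrow> real) \<Rightarrow> real \<Rightarrow> real \<Rightarrow> 'a \<Rightarrow> (nat \<Rightarrow> 'a) \<Rightarrow> (nat \<Rightarrow> 'a) \<Rightarrow>
   (nat \<Rightarrow> 'a \<Rightarrow> real) \<Rightarrow> nat \<Rightarrow> 'a \<Rightarrow> real" where
  "bundle_model mt f m \<rho> c L G M 0 x = f (L 0) + G 0 \<bullet> (x - L 0)"
| "bundle_model mt f m \<rho> c L G M (Suc k) x =
     (let new = cut f m c L G (Suc k) x;
          agg = bundle_model mt f m \<rho> c L G M k (L (Suc k))
                  + (\<rho> *\<^sub>R (c - L (Suc k))) \<bullet> (x - L (Suc k))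
      in case mt of
           Full_Memory \<Rightarrow> Max ((\<lambda>i. cut f m c L G i x) ` {0..Suc k})
         | Two_Cut \<Rightarrow> max new agg
         | General \<Rightarrow> max (M (Suc k) x) (max new agg))"

definition descent_test ::
  "('a::real_inner \<Rightarrow> real) \<Rightarrow> real \<Rightarrow> real \<Rightarrow> 'a \<Rightarrow> ('a \<Rightarrow> real) \<Rightarrow> 'a \<Rightarrow> bool" where
  "descent_test f m \<beta> c fk y \<longleftrightarrow>
     \<beta> * (f c - fk y) \<le> f c - (f y + m / 2 * (norm (y - c))\<^sup>2)"

text \<open>
  \<open>L 0, \<dots>, L n\<close> are the iterates of the first \<open>n\<close> iterations of a call with centre \<open>c\<close>: none of
  the first \<open>n - 1\<close> iterations stopped the call, while the last one may or may not do so. The set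
  \<open>S\<close> is the enlarged sublevel set and \<open>l\<^sub>M\<close> the Lipschitz constant of \<open>M k\<close> on it.
\<close>

definition prox_descent_steps ::
  "model_type \<Rightarrow> ('a::real_inner \<Rightarrow> real) \<Rightarrow> real \<Rightarrow> real \<Rightarrow> 'a set \<Rightarrow> real \<Rightarrow> real \<Rightarrow> 'a \<Rightarrow> nat \<Rightarrow>
   (nat \<Rightarrow> 'a) \<Rightarrow> (nat \<Rightarrow> 'a) \<Rightarrow> (nat \<Rightarrow> 'a \<Rightarrow> real) \<Rightarrow> bool" where
  "prox_descent_steps mt f m l\<^sub>M S \<beta> \<rho> c n L G M \<longleftrightarrow>
     L 0 = c \<and>
     (\<forall>k<n. G k - m *\<^sub>R (L k - c) \<in> frechet_subdiff f (L k)) \<and>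
     (mt = General \<longrightarrow> (\<forall>k. 1 \<le> k \<and> k < n \<longrightarrow>
        lipschitz_on l\<^sub>M S (M k) \<and> convex_on UNIV (M k) \<and>
        (\<forall>x \<in> largest_ball (interior S) c. M k x \<le> f x + m / 2 * (norm (x - c))\<^sup>2))) \<and>
     (\<forall>k<n. is_arg_min (\<lambda>x. bundle_model mt f m \<rho> c L G M k x + \<rho> / 2 * (norm (x - c))\<^sup>2)
              (\<lambda>_. True) (L (Suc k))) \<and>
     (\<forall>k. Suc k < n \<longrightarrow> \<not> descent_test f m \<beta> c (bundle_model mt f m \<rho> c L G M k) (L (Suc k)))"

definition prox_descent_returns ::
  "model_type \<Rightarrow> ('a::real_inner \<Rightarrow> real) \<Rightarrow> real \<Rightarrow> real \<Rightarrow> 'a set \<Rightarrow> real \<Rightarrow> real \<Rightarrow> 'a \<Rightarrow> nat \<Rightarrow>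
   (nat \<Rightarrow> 'a) \<Rightarrow> (nat \<Rightarrow> 'a) \<Rightarrow> (nat \<Rightarrow> 'a \<Rightarrow> real) \<Rightarrow> 'a \<Rightarrow> bool" where
  "prox_descent_returns mt f m l\<^sub>M S \<beta> \<rho> c n L G M y \<longleftrightarrow>
     prox_descent_steps mt f m l\<^sub>M S \<beta> \<rho> c n L G M \<and> 0 < n \<and>
     descent_test f m \<beta> c (bundle_model mt f m \<rho> c L G M (n - 1)) (L n) \<and> y = L n"

text \<open>
  An execution observed after finitely many iterations: the calls \<open>0, \<dots>, T - 1\<close> have returned,
  call \<open>t\<close> after \<open>n t\<close> inner iterations, and \<open>n T\<close> iterations of call \<open>T\<close> have been made.
  The outer iterates computed so far are \<open>K 0, \<dots>, K T\<close>. Since a call need not return, all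
  observations of an execution are of this form.
\<close>

definition bundle_execution ::
  "model_type \<Rightarrow> ('a::real_inner \<Rightarrow> real) \<Rightarrow> real \<Rightarrow> real \<Rightarrow> 'a set \<Rightarrow> real \<Rightarrow> real \<Rightarrow> 'a \<Rightarrow> nat \<Rightarrow>
   (nat \<Rightarrow> 'a) \<Rightarrow> (nat \<Rightarrow> nat) \<Rightarrow> (nat \<Rightarrow> nat \<Rightarrow> 'a) \<Rightarrow> (nat \<Rightarrow> nat \<Rightarrow> 'a) \<Rightarrow>
   (nat \<Rightarrow> nat \<Rightarrow> 'a \<Rightarrow> real) \<Rightarrow> bool" where
  "bundle_execution mt f m l\<^sub>M S \<beta> \<rho> K0 T K n L G M \<longleftrightarrow>
     K 0 = K0 \<and>
     (\<forall>t<T. prox_descent_returns mt f m l\<^sub>M S \<beta> \<rho> (K t) (n t) (L t) (G t) (M t) (K (Suc t))) \<and>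
     prox_descent_steps mt f m l\<^sub>M S \<beta> \<rho> (K T) (n T) (L T) (G T) (M T)"

end

theory Submission
  imports Defs "HOL-Complex_Analysis.Conformal_Mappings"
begin

text \<open>
  Three ideas carry the proof.

  A call with centre \<open>c\<close> works on the ball \<open>U\<close> around \<open>c\<close> on which the regularized cost
  \<open>F x = f x + m / 2 * norm (x - c) ^ 2\<close> is convex. The aggregate slope \<open>s = \<rho> (c - L)\<close> of a
  proximal step is a subgradient of a minorant of \<open>F\<close>, so it is an \<open>e\<close>-subgradient of \<open>f\<close> at \<open>c\<close>,
  where \<open>e + norm s ^ 2 / (2 \<rho>)\<close> is exactly the gap between \<open>f c\<close> and the optimal value of the
  proximal subproblem (\<open>small_gap_stationary\<close>). As long as \<open>c\<close> is not stationary, the gap therefore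
  exceeds a constant times \<open>\<tau> = min (\<eta>\<^sup>2) \<epsilon>\<close>. A step that passes the descent test lowers \<open>f\<close> by
  at least \<open>\<beta>\<close> times the gap, so there are \<open>O(1 / \<tau>)\<close> calls. A step that fails it lowers the gap
  \<open>g\<close> by a multiple of \<open>g\<^sup>2\<close> (\<open>gap_null_step\<close>), so each call takes \<open>O(1 / \<tau>)\<close> steps. The product
  of the two counts is the rate (\<open>total_iterations_le\<close>).

  Every iterate must stay where convexity and the Lipschitz bound are available. All pieces of a
  model have slope less than \<open>\<rho> d\<close> at points within distance \<open>d\<close> of \<open>c\<close>, and a convex model with such
  slopes cannot move its proximal step by \<open>d\<close> or more (\<open>prox_step_in_ball\<close>). The descent test then
  keeps the outer iterates in the initial sublevel set.

  This requires that the margin \<open>d\<close> between the two sublevel sets be positive. The larger set has to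
  be closed with nonempty frontier, which is coercivity of the H-infinity cost. For a
  stabilizing gain the cost bounds \<open>(I - \<zeta> N)\<^sup>-\<^sup>1\<close> and \<open>K C (I - \<zeta> N)\<^sup>-\<^sup>1\<close> on the unit circle, where
  \<open>N\<close> is the closed-loop matrix. Both are holomorphic on the disc, and the maximum modulus principle
  carries the bounds inside (\<open>resolvent_bound_on_disc\<close>). A uniform bound on the whole disc is a
  closed condition that implies stability, and its value at \<open>\<zeta> = 0\<close> bounds the gain. Together with
  continuity of the cost, the Lipschitz constant \<open>l\<close> gives \<open>d \<ge> J K0 / l\<close> (\<open>sublevel_margin\<close>).
\<close>

section \<open>Weakly convex functions on a ball\<close>

lemma ball_subset_largest_ball:
  assumes "ball x r \<subseteq> S"
  shows "ball x r \<subseteq> largest_ball S x"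
  using assms unfolding largest_ball_def by blast

lemma largest_ball_subset: "largest_ball S x \<subseteq> S"
  unfolding largest_ball_def by blast

lemma convex_largest_ball: "convex (largest_ball S x)"
proof -
  have "u *\<^sub>R y + v *\<^sub>R z \<in> largest_ball S x"
    if yz: "y \<in> largest_ball S x" "z \<in> largest_ball S x" and uv: "0 \<le> u" "0 \<le> v" "u + v = 1"
    for y z and u v :: real
  proof -
    obtain r s where r: "ball x r \<subseteq> S" "y \<in> ball x r" and s: "ball x s \<subseteq> S" "z \<in> ball x s"
      using yz unfolding largest_ball_def by blast
    have "ball x (max r s) \<subseteq> S" using r(1) s(1) by (cases "r \<le> s") (auto simp: max_def)
    then have "ball x (max r s) \<subseteq> largest_ball S x" by (rule ball_subset_largest_ball)
    moreover have "y \<in> ball x (max r s)" "z \<in> ball x (max r s)" using r(2) s(2) by auto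
    then have "u *\<^sub>R y + v *\<^sub>R z \<in> ball x (max r s)"
      using uv by (rule convexD[OF convex_ball])
    ultimately show ?thesis by blast
  qed
  then show ?thesis by (auto simp: convex_def)
qed

lemma frechet_subdiffD:
  assumes v: "v \<in> frechet_subdiff f x" and e: "0 < e"
  shows "\<forall>\<^sub>F y in at x. f y \<ge> f x + v \<bullet> (y - x) - e * norm (y - x)"
proof -
  have "ereal (- e) < Liminf (at x) (\<lambda>y. ereal ((f y - f x - v \<bullet> (y - x)) / norm (y - x)))"
    using v e unfolding frechet_subdiff_def
    by (metis (mono_tags, lifting) ereal_less(1) less_le_trans mem_Collect_eq neg_less_0_iff_less
        zero_ereal_def ereal_less_eq(3) less_ereal.simps(1))
  then have "\<forall>\<^sub>F y in at x. ereal (- e) < ereal ((f y - f x - v \<bullet> (y - x)) / norm (y - x))"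
    by (rule less_LiminfD)
  moreover have "\<forall>\<^sub>F y in at x. y \<noteq> x" by (simp add: eventually_at_filter)
  ultimately show ?thesis
  proof eventually_elim
    case (elim y)
    then have "- e < (f y - f x - v \<bullet> (y - x)) / norm (y - x)" "norm (y - x) > 0" by auto
    then have "- e * norm (y - x) < f y - f x - v \<bullet> (y - x)" by (simp add: pos_less_divide_eq)
    then show ?case by simp
  qed
qed

text \<open>Both consequences below, the Lipschitz bound on subgradients and the passage to convex
  subgradients, follow from the Frechet condition along a single ray.\<close>

lemma frechet_subdiff_ray:
  assumes v: "v \<in> frechet_subdiff f x" and e: "0 < e"
  shows "\<forall>\<^sub>F t in at_right 0. f (x + t *\<^sub>R h) \<ge> f x + t * (v \<bullet> h) - e * t"
proof (cases "h = 0")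
  case True
  then show ?thesis
    using e by (auto simp: eventually_at_right_less intro: eventually_mono[OF eventually_at_right_less])
next
  case False
  then have e': "e / norm h > 0" using e by simp
  have "((\<lambda>t. x + t *\<^sub>R h) \<longlongrightarrow> x + 0 *\<^sub>R h) (at_right 0)"
    by (intro tendsto_intros)
  moreover have "\<forall>\<^sub>F t in at_right (0::real). x + t *\<^sub>R h \<noteq> x"
    using False by (auto intro: eventually_mono[OF eventually_at_right_less])
  ultimately have "filterlim (\<lambda>t. x + t *\<^sub>R h) (at x) (at_right 0)"
    by (simp add: filterlim_at)
  from eventually_compose_filterlim[OF frechet_subdiffD[OF v e'] this]
       eventually_at_right_less[of "0::real"]
  show ?thesis
  proof eventually_elim
    case (elim t)
    then show ?case using False by (simp add: field_simps)
  qed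
qed

lemma frechet_subdiff_norm_le:
  assumes v: "v \<in> frechet_subdiff f x" and x: "x \<in> interior S" and lip: "lipschitz_on l S f"
  shows "norm v \<le> l"
proof (rule field_le_epsilon)
  fix e :: real assume e: "0 < e"
  show "norm v \<le> l + e"
  proof (cases "v = 0")
    case True
    then show ?thesis using lipschitz_on_nonneg[OF lip] e by simp
  next
    case False
    then have e': "e * norm v > 0" using e by simp
    have "((\<lambda>t. x + t *\<^sub>R v) \<longlongrightarrow> x + 0 *\<^sub>R v) (at_right 0)"
      by (intro tendsto_intros)
    then have "\<forall>\<^sub>F t in at_right 0. x + t *\<^sub>R v \<in> interior S"
      by (rule topological_tendstoD) (use x in auto)
    with frechet_subdiff_ray[OF v e', of v] eventually_at_right_less[of "0::real"]
    have "\<forall>\<^sub>F t in at_right (0::real). norm v \<le> l + e"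
    proof eventually_elim
      case (elim t)
      then have "x + t *\<^sub>R v \<in> S" "x \<in> S" using x interior_subset by auto
      from lipschitz_onD[OF lip this] elim
      have "f (x + t *\<^sub>R v) - f x \<le> l * (t * norm v)"
        by (simp add: dist_norm)
      with elim have "t * (v \<bullet> v) - e * norm v * t \<le> l * (t * norm v)" by linarith
      then have "(t * norm v) * norm v \<le> (t * norm v) * (l + e)"
        by (simp add: dot_square_norm power2_eq_square algebra_simps)
      then show ?case using elim False by simp
    qed
    then show ?thesis
      by simp
  qed
qed

text \<open>A subgradient of a convex function is only a first-order condition; convexity propagates it
  from an infinitesimal step towards \<open>y\<close> to \<open>y\<close> itself.\<close>

lemma convexified_subgradient:
  fixes f :: "'a::real_inner \<Rightarrow> real"
  assumes cvx: "convex_on U (\<lambda>x. f x + m / 2 * (norm (x - c))\<^sup>2)" and m: "0 \<le> m"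
    and x: "x \<in> U" and y: "y \<in> U" and v: "g - m *\<^sub>R (x - c) \<in> frechet_subdiff f x"
  shows "f y + m / 2 * (norm (y - c))\<^sup>2 \<ge> f x + m / 2 * (norm (x - c))\<^sup>2 + g \<bullet> (y - x)"
proof (rule field_le_epsilon)
  fix e :: real assume e: "0 < e"
  let ?F = "\<lambda>x. f x + m / 2 * (norm (x - c))\<^sup>2" and ?h = "y - x"
  have "\<forall>\<^sub>F t in at_right (0::real). t < 1"
    by (rule eventually_at_rightI[of 0 1]) auto
  with frechet_subdiff_ray[OF v e, of ?h] eventually_at_right_less[of "0::real"]
  have "\<forall>\<^sub>F t in at_right (0::real). ?F x + g \<bullet> ?h \<le> ?F y + e"
  proof eventually_elim
    case (elim t)
    have sq: "(norm (x + t *\<^sub>R ?h - c))\<^sup>2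
        = (norm (x - c))\<^sup>2 + 2 * t * ((x - c) \<bullet> ?h) + t\<^sup>2 * (norm ?h)\<^sup>2"
      unfolding power2_norm_eq_inner
      by (simp add: inner_simps inner_commute power2_eq_square algebra_simps)
    have "x + t *\<^sub>R ?h = (1 - t) *\<^sub>R x + t *\<^sub>R y" by (simp add: algebra_simps)
    then have "?F (x + t *\<^sub>R ?h) \<le> (1 - t) * ?F x + t * ?F y"
      using convex_onD[OF cvx, of t x y] elim x y by simp
    moreover have "?F (x + t *\<^sub>R ?h) \<ge> ?F x + t * (g \<bullet> ?h) - e * t"
    proof -
      have "f (x + t *\<^sub>R ?h) \<ge> f x + t * (g \<bullet> ?h) - t * m * ((x - c) \<bullet> ?h) - e * t"
        using elim by (simp add: inner_diff_left algebra_simps)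
      moreover have "0 \<le> m / 2 * (t\<^sup>2 * (norm ?h)\<^sup>2)" using m by simp
      ultimately show ?thesis unfolding sq by (simp add: algebra_simps)
    qed
    moreover have "t * (a + b) \<le> t * (q + e)"
      if "p \<le> (1 - t) * a + t * q" "a + t * b - e * t \<le> p" for a b p q :: real
      using that by (simp add: algebra_simps)
    ultimately have "t * (?F x + g \<bullet> ?h) \<le> t * (?F y + e)" by blast
    then show ?case using elim by (simp del: mult_le_cancel_left_pos add: mult_le_cancel_left_pos)
  qed
  then show "?F x + g \<bullet> ?h \<le> ?F y + e"
    by simp
qed

lemma weakly_convex_on_shift:
  assumes "weakly_convex_on m U f"
  shows "convex_on U (\<lambda>x. f x + m / 2 * (norm (x - c))\<^sup>2)"
proof -
  have cvx: "convex_on U (\<lambda>x. f x + m / 2 * (norm x)\<^sup>2)"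
    using assms by (simp add: weakly_convex_on_def)
  have "convex_on U (\<lambda>x. - m * (c \<bullet> x) + m / 2 * (norm c)\<^sup>2)"
    using convex_on_imp_convex[OF cvx]
    by (intro convex_onI) (auto simp: inner_simps field_simps)
  from convex_on_add[OF cvx this]
  have "convex_on U (\<lambda>x. f x + m / 2 * (norm x)\<^sup>2 + (- m * (c \<bullet> x) + m / 2 * (norm c)\<^sup>2))" .
  also have "(\<lambda>x. f x + m / 2 * (norm x)\<^sup>2 + (- m * (c \<bullet> x) + m / 2 * (norm c)\<^sup>2))
      = (\<lambda>x. f x + m / 2 * (norm (x - c))\<^sup>2)"
    by (rule ext) (simp add: power2_norm_eq_inner inner_simps inner_commute field_simps)
  finally show ?thesis .
qed

section \<open>Proximal steps on a convex model\<close>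

text \<open>First-order optimality of a proximal step, read off by moving from \<open>L\<close> towards \<open>y\<close>.\<close>

lemma prox_subgradient:
  fixes h :: "'a::real_inner \<Rightarrow> real"
  assumes cvx: "convex_on UNIV h"
    and argmin: "is_arg_min (\<lambda>x. h x + \<rho> / 2 * (norm (x - c))\<^sup>2) (\<lambda>_. True) L"
  shows "h y \<ge> h L + \<rho> * ((c - L) \<bullet> (y - L))"
proof -
  let ?r = "y - L"
  define a where "a = h L + \<rho> * ((c - L) \<bullet> ?r) - h y"
  define b where "b = \<rho> / 2 * (norm ?r)\<^sup>2"
  have "a \<le> t * b" if t: "0 < t" "t < 1" for t
  proof -
    have sq: "(norm (L + t *\<^sub>R ?r - c))\<^sup>2
        = (norm (L - c))\<^sup>2 - 2 * t * ((c - L) \<bullet> ?r) + t\<^sup>2 * (norm ?r)\<^sup>2"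
      unfolding power2_norm_eq_inner
      by (simp add: inner_simps inner_commute power2_eq_square algebra_simps)
    have "L + t *\<^sub>R ?r = (1 - t) *\<^sub>R L + t *\<^sub>R y" by (simp add: algebra_simps)
    then have "h (L + t *\<^sub>R ?r) \<le> (1 - t) * h L + t * h y"
      using convex_onD[OF cvx, of t L y] t by simp
    moreover have "h L + \<rho> / 2 * (norm (L - c))\<^sup>2
        \<le> h (L + t *\<^sub>R ?r) + \<rho> / 2 * (norm (L + t *\<^sub>R ?r - c))\<^sup>2"
      using argmin unfolding is_arg_min_def by (meson linorder_not_le)
    ultimately have "t * a \<le> t * (t * b)"
      unfolding sq a_def b_def by (simp add: algebra_simps power2_eq_square)
    then show ?thesis using t by simp
  qed
  then have "\<forall>\<^sub>F t in at_right 0. a \<le> t * b"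
    by (intro eventually_at_rightI[of 0 1]) auto
  moreover have "((\<lambda>t. t * b) \<longlongrightarrow> 0 * b) (at_right 0)" by (intro tendsto_intros)
  ultimately have "a \<le> 0"
    using tendsto_lowerbound[of "\<lambda>t. t * b" "0 * b" "at_right 0" a] by simp
  then show ?thesis by (simp add: a_def)
qed

text \<open>A model that decreases from \<open>c\<close> with slope less than \<open>\<rho> * d\<close> cannot pull the proximal step
  out of the ball of radius \<open>d\<close>: by convexity, the average slope on the segment from \<open>c\<close> to \<open>L\<close>,
  at least \<open>\<rho> * norm (L - c)\<close>, is already attained near \<open>c\<close>.\<close>

lemma prox_step_in_ball:
  fixes h :: "'a::real_inner \<Rightarrow> real"
  assumes cvx: "convex_on UNIV h" and \<rho>: "0 < \<rho>" and d: "0 < d"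
    and sub: "h c \<ge> h L + \<rho> * (norm (L - c))\<^sup>2"
    and slope: "\<And>p. 0 < norm (p - c) \<Longrightarrow> norm (p - c) < d \<Longrightarrow> h c - h p < \<rho> * d * norm (p - c)"
  shows "norm (L - c) < d"
proof (rule ccontr)
  let ?D = "norm (L - c)"
  assume "\<not> ?D < d"
  then have D: "d \<le> ?D" "0 < ?D" using d by auto
  \<comment> \<open>The point \<open>p\<close> on the segment from \<open>c\<close> to \<open>L\<close> has distance \<open>d / 2\<close> from \<open>c\<close>.\<close>
  define t where "t = d / (2 * ?D)"
  have t: "0 < t" "t < 1" unfolding t_def using D d by (auto simp: field_simps)
  define p where "p = (1 - t) *\<^sub>R c + t *\<^sub>R L"
  have "p - c = t *\<^sub>R (L - c)" by (simp add: p_def algebra_simps)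
  then have np: "norm (p - c) = t * ?D" using t by simp
  then have "h c - h p < \<rho> * d * (t * ?D)"
    using slope[of p] D d t by (simp add: t_def)
  moreover have "h p \<le> (1 - t) * h c + t * h L"
    unfolding p_def using convex_onD[OF cvx, of t c L] t by simp
  moreover have "t * (h L + \<rho> * ?D\<^sup>2) \<le> t * h c" using sub t by simp
  ultimately have "t * (\<rho> * ?D\<^sup>2) < \<rho> * d * (t * ?D)" by (simp add: algebra_simps)
  then have "(t * \<rho> * ?D) * ?D < (t * \<rho> * ?D) * d" by (simp add: algebra_simps power2_eq_square)
  then show False using D t \<rho> by (simp add: mult_less_cancel_left)
qed

text \<open>Minimizing the maximum of two affine functions plus the proximal term: a convex combination
  with weight \<open>\<theta>\<close> on the second bounds the minimum from below.\<close>

lemma two_cut_prox_gain: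
  fixes c L x g :: "'a::real_inner"
  assumes \<rho>: "0 < \<rho>" and \<theta>: "0 \<le> \<theta>" "\<theta> \<le> 1"
    and agg: "w \<ge> u + \<rho> * ((c - L) \<bullet> (x - L))" and new: "w \<ge> u + a + g \<bullet> (x - L)"
    and H: "norm (g - \<rho> *\<^sub>R (c - L)) \<le> H"
  shows "w + \<rho> / 2 * (norm (x - c))\<^sup>2
     \<ge> u + \<rho> / 2 * (norm (L - c))\<^sup>2 + \<theta> * a - \<theta>\<^sup>2 * H\<^sup>2 / (2 * \<rho>)"
proof -
  let ?s = "\<rho> *\<^sub>R (c - L)" and ?r = "x - L"
  \<comment> \<open>The proximal term cancels the slope of the first function at its minimizer \<open>L\<close>, leaving only
    the difference of the two slopes to be balanced against the quadratic term.\<close>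
  have "w = (1 - \<theta>) * w + \<theta> * w" by (simp add: algebra_simps)
  also have "\<dots> \<ge> (1 - \<theta>) * (u + \<rho> * ((c - L) \<bullet> ?r)) + \<theta> * (u + a + g \<bullet> ?r)"
    by (intro add_mono mult_left_mono agg new) (use \<theta> in auto)
  finally have w: "w \<ge> u + \<theta> * a + ?s \<bullet> ?r + \<theta> * ((g - ?s) \<bullet> ?r)"
    by (simp add: inner_diff_left algebra_simps)
  have sq: "(norm (x - c))\<^sup>2 = (norm (L - c))\<^sup>2 - 2 * ((c - L) \<bullet> ?r) + (norm ?r)\<^sup>2"
    unfolding power2_norm_eq_inner by (simp add: inner_simps inner_commute algebra_simps)
  have "\<theta> * ((g - ?s) \<bullet> ?r) \<ge> - (\<theta> * (H * norm ?r))"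
  proof -
    have "\<bar>(g - ?s) \<bullet> ?r\<bar> \<le> H * norm ?r"
      using Cauchy_Schwarz_ineq2[of "g - ?s" ?r] H by (meson mult_right_mono norm_ge_zero order_trans)
    then have "- (H * norm ?r) \<le> (g - ?s) \<bullet> ?r" by linarith
    from mult_left_mono[OF this \<theta>(1)] show ?thesis by simp
  qed
  moreover have "\<rho> / 2 * (norm ?r)\<^sup>2 - \<theta> * (H * norm ?r) \<ge> - (\<theta>\<^sup>2 * H\<^sup>2 / (2 * \<rho>))"
  proof -
    have "0 \<le> (\<rho> * norm ?r - \<theta> * H)\<^sup>2 / (2 * \<rho>)" using \<rho> by simp
    also have "\<dots> = \<rho> / 2 * (norm ?r)\<^sup>2 - \<theta> * (H * norm ?r) + \<theta>\<^sup>2 * H\<^sup>2 / (2 * \<rho>)"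
      using \<rho> by (simp add: field_simps power2_eq_square)
    finally show ?thesis by simp
  qed
  moreover have "\<rho> / 2 * (norm (x - c))\<^sup>2
      = \<rho> / 2 * (norm (L - c))\<^sup>2 - ?s \<bullet> ?r + \<rho> / 2 * (norm ?r)\<^sup>2"
    unfolding sq by (simp add: algebra_simps)
  ultimately show ?thesis using w by linarith
qed

section \<open>One call of the proximal descent\<close>

lemma convex_on_max:
  assumes "convex_on A g" "convex_on A h"
  shows "convex_on A (\<lambda>x. max (g x) (h x) :: real)"
proof (rule convex_onI)
  fix t :: real and x y assume t: "0 < t" "t < 1" and xy: "x \<in> A" "y \<in> A"
  let ?z = "(1 - t) *\<^sub>R x + t *\<^sub>R y"
  have "g ?z \<le> (1 - t) * g x + t * g y" "h ?z \<le> (1 - t) * h x + t * h y"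
    using convex_onD[OF assms(1)] convex_onD[OF assms(2)] t xy by simp_all
  moreover have "(1 - t) * g x + t * g y \<le> (1 - t) * max (g x) (h x) + t * max (g y) (h y)"
    "(1 - t) * h x + t * h y \<le> (1 - t) * max (g x) (h x) + t * max (g y) (h y)"
    using t by (intro add_mono mult_left_mono; simp)+
  ultimately show "max (g ?z) (h ?z) \<le> (1 - t) * max (g x) (h x) + t * max (g y) (h y)" by linarith
qed (use assms convex_on_imp_convex in blast)

text \<open>Cuts taken within distance \<open>d\<close> of the centre \<open>c\<close> have slope at most \<open>l + m * d\<close>. The last
  assumption keeps this below the slope \<open>\<rho> * d\<close> of the proximal term at distance \<open>d\<close>.\<close>

locale prox_center =
  fixes f :: "'a::real_inner \<Rightarrow> real" and m l d \<rho> :: real and S :: "'a set" and c :: 'a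
  assumes m_pos: "0 < m"
    and weak: "\<And>U. U \<subseteq> S \<Longrightarrow> convex U \<Longrightarrow> weakly_convex_on m U f"
    and lip: "lipschitz_on l S f"
    and d_pos: "0 < d"
    and ball_sub: "ball c d \<subseteq> interior S"
    and rho: "l + m * d < \<rho> * d"
begin

abbreviation "U \<equiv> largest_ball (interior S) c"

abbreviation "F x \<equiv> f x + m / 2 * (norm (x - c))\<^sup>2"

lemma l_nonneg: "0 \<le> l"
  using lip by (rule lipschitz_on_nonneg)

lemma rho_pos: "0 < \<rho>"
proof -
  have "0 < l + m * d" using l_nonneg m_pos d_pos by (simp add: add_nonneg_pos)
  then have "0 < \<rho> * d" using rho by linarith
  then show ?thesis using d_pos by (simp add: zero_less_mult_iff)
qed

lemma ball_sub_U: "ball c d \<subseteq> U"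
  using ball_sub by (rule ball_subset_largest_ball)

lemma in_U: "norm (x - c) < d \<Longrightarrow> x \<in> U"
  using ball_sub_U by (auto simp: dist_norm norm_minus_commute)

lemma in_interior: "norm (x - c) < d \<Longrightarrow> x \<in> interior S"
  using ball_sub by (auto simp: dist_norm norm_minus_commute)

lemma in_S: "norm (x - c) < d \<Longrightarrow> x \<in> S"
  using in_interior interior_subset by blast

lemma F_convex: "convex_on U F"
proof (rule weakly_convex_on_shift, rule weak)
  show "U \<subseteq> S" using largest_ball_subset interior_subset by (rule order_trans)
qed (rule convex_largest_ball)

lemma cut_minorant:
  assumes "norm (x - c) < d" "g - m *\<^sub>R (x - c) \<in> frechet_subdiff f x" "y \<in> U"
  shows "F x + g \<bullet> (y - x) \<le> F y"
  using convexified_subgradient[OF F_convex _ in_U] assms m_pos by simp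

lemma cut_slope:
  assumes x: "norm (x - c) < d" and g: "g - m *\<^sub>R (x - c) \<in> frechet_subdiff f x"
  shows "norm g < \<rho> * d"
proof -
  have "norm (g - m *\<^sub>R (x - c)) \<le> l"
    using frechet_subdiff_norm_le[OF g in_interior[OF x] lip] .
  moreover have "norm (m *\<^sub>R (x - c)) \<le> m * d" using x m_pos by simp
  ultimately have "norm g \<le> l + m * d" using norm_triangle_sub[of g "m *\<^sub>R (x - c)"] by linarith
  then show ?thesis using rho by simp
qed

end

locale prox_call = prox_center f m l d \<rho> S c
  for f :: "'a::real_inner \<Rightarrow> real" and m l d \<rho> :: real and S :: "'a set" and c :: 'a +
  fixes mt :: model_type and l\<^sub>M \<beta> :: real and n :: nat
    and L G :: "nat \<Rightarrow> 'a" and M :: "nat \<Rightarrow> 'a \<Rightarrow> real"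
  assumes lM: "l\<^sub>M < \<rho> * d"
    and beta: "0 < \<beta>" "\<beta> < 1"
    and steps: "prox_descent_steps mt f m l\<^sub>M S \<beta> \<rho> c n L G M"
begin

abbreviation "model \<equiv> bundle_model mt f m \<rho> c L G M"

lemma start: "L 0 = c"
  using steps by (simp add: prox_descent_steps_def)

lemma slope: "k < n \<Longrightarrow> G k - m *\<^sub>R (L k - c) \<in> frechet_subdiff f (L k)"
  using steps by (simp add: prox_descent_steps_def)

lemma user_model:
  assumes "mt = General" "Suc k < n"
  shows "lipschitz_on l\<^sub>M S (M (Suc k))" "convex_on UNIV (M (Suc k))"
    "\<And>x. x \<in> U \<Longrightarrow> M (Suc k) x \<le> F x"
  using steps assms unfolding prox_descent_steps_def by (auto dest!: spec[of _ "Suc k"])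

lemma argmin:
  "k < n \<Longrightarrow> is_arg_min (\<lambda>x. model k x + \<rho> / 2 * (norm (x - c))\<^sup>2) (\<lambda>_. True) (L (Suc k))"
  using steps by (simp add: prox_descent_steps_def)

lemma null_step: "Suc k < n \<Longrightarrow> \<not> descent_test f m \<beta> c (model k) (L (Suc k))"
  using steps by (simp add: prox_descent_steps_def)

lemma convex_on_affine: "convex_on UNIV (\<lambda>x. a + g \<bullet> (x - y))"
  by (intro convex_onI) (auto simp: inner_simps algebra_simps)

lemma model_convex: "k < n \<Longrightarrow> convex_on UNIV (model k)"
proof (cases k)
  case 0
  have "model 0 = (\<lambda>x. f (L 0) + G 0 \<bullet> (x - L 0))" by auto
  then show ?thesis using 0 convex_on_affine by simp
next
  case (Suc j)
  assume "k < n"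
  have new: "convex_on UNIV (cut f m c L G i)" for i
    unfolding cut_def by (rule convex_on_affine)
  have agg: "convex_on UNIV (\<lambda>x. model j (L (Suc j)) + (\<rho> *\<^sub>R (c - L (Suc j))) \<bullet> (x - L (Suc j)))"
    by (rule convex_on_affine)
  show ?thesis
  proof (cases mt)
    case Full_Memory
    have "convex_on UNIV (\<lambda>x. Max ((\<lambda>i. cut f m c L G i x) ` {0..Suc j}))"
    proof (rule convex_onI)
      fix t :: real and x y assume t: "0 < t" "t < 1"
      let ?m = "\<lambda>x. Max ((\<lambda>i. cut f m c L G i x) ` {0..Suc j})"
      have "cut f m c L G i ((1 - t) *\<^sub>R x + t *\<^sub>R y) \<le> (1 - t) * ?m x + t * ?m y"
        if "i \<in> {0..Suc j}" for i
      proof -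
        have "cut f m c L G i ((1 - t) *\<^sub>R x + t *\<^sub>R y)
            \<le> (1 - t) * cut f m c L G i x + t * cut f m c L G i y"
          using convex_onD[OF new, of t x y i] t by simp
        also have "\<dots> \<le> (1 - t) * ?m x + t * ?m y"
          by (intro add_mono mult_left_mono Max_ge) (use t that in auto)
        finally show ?thesis .
      qed
      then show "?m ((1 - t) *\<^sub>R x + t *\<^sub>R y) \<le> (1 - t) * ?m x + t * ?m y"
        by (intro Max.boundedI) auto
    qed simp
    moreover have "bundle_model mt f m \<rho> c L G M (Suc j)
        = (\<lambda>x. Max ((\<lambda>i. cut f m c L G i x) ` {0..Suc j}))"
      using Full_Memory by (auto simp: Let_def)
    ultimately show ?thesis using Suc by simp
  next
    case Two_Cut
    have "bundle_model mt f m \<rho> c L G M (Suc j)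
      = (\<lambda>x. max (cut f m c L G (Suc j) x)
          (model j (L (Suc j)) + (\<rho> *\<^sub>R (c - L (Suc j))) \<bullet> (x - L (Suc j))))"
      using Two_Cut by (auto simp: Let_def)
    then show ?thesis using Suc convex_on_max[OF new agg, of "Suc j"] by simp
  next
    case General
    have "bundle_model mt f m \<rho> c L G M (Suc j)
      = (\<lambda>x. max (M (Suc j) x) (max (cut f m c L G (Suc j) x)
          (model j (L (Suc j)) + (\<rho> *\<^sub>R (c - L (Suc j))) \<bullet> (x - L (Suc j)))))"
      using General by (auto simp: Let_def)
    then show ?thesis
      using Suc \<open>k < n\<close> convex_on_max[OF user_model(2) convex_on_max[OF new agg, of "Suc j"]] General
      by simp
  qed
qed

lemma agg_subgradient:
  "k < n \<Longrightarrow> model k (L (Suc k)) + \<rho> * ((c - L (Suc k)) \<bullet> (y - L (Suc k))) \<le> model k y"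
  using prox_subgradient[OF model_convex argmin] .

text \<open>Cuts and user-supplied models are flat enough because \<open>\<rho>\<close> is large. The aggregate slope
  \<open>\<rho> * (c - L k)\<close> is small because the previous proximal step already stayed in the ball.\<close>

lemma model_drop:
  assumes k: "k < n" and near: "\<And>i. i \<le> k \<Longrightarrow> norm (L i - c) < d"
    and p: "0 < norm (p - c)" "norm (p - c) < d"
  shows "model k c - model k p < \<rho> * d * norm (p - c)"
proof -
  have inner_less: "g \<bullet> (c - p) < \<rho> * d * norm (p - c)" if "norm g < \<rho> * d" for g
  proof -
    have "g \<bullet> (c - p) \<le> norm g * norm (p - c)"
      using norm_cauchy_schwarz[of g "c - p"] by (simp add: norm_minus_commute)
    also have "\<dots> < \<rho> * d * norm (p - c)" using that p by simp
    finally show ?thesis .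
  qed
  have new: "cut f m c L G i c - cut f m c L G i p < \<rho> * d * norm (p - c)" if "i \<le> k" for i
    using inner_less[OF cut_slope[OF near slope, OF that]] that k
    by (simp add: cut_def inner_diff_right)
  show ?thesis
  proof (cases k)
    case 0
    then show ?thesis using new[of 0] by (simp add: cut_def start)
  next
    case (Suc j)
    define s where "s = \<rho> *\<^sub>R (c - L (Suc j))"
    have "norm s < \<rho> * d"
      using near[of "Suc j"] Suc rho_pos by (simp add: s_def norm_minus_commute)
    from inner_less[OF this]
    have agg: "(a + s \<bullet> (c - y)) - (a + s \<bullet> (p - y)) < \<rho> * d * norm (p - c)" for a y
      by (simp add: inner_diff_right)
    have max_less: "max a b - max a' b' < e" if "a - a' < e" "b - b' < e" for a b a' b' e :: real
      using that by linarith
    show ?thesis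
    proof (cases mt)
      case Full_Memory
      let ?m = "\<lambda>x. Max ((\<lambda>i. cut f m c L G i x) ` {0..Suc j})"
      have "?m c \<in> (\<lambda>i. cut f m c L G i c) ` {0..Suc j}" by (rule Max_in) auto
      then obtain i where i: "?m c = cut f m c L G i c" "i \<in> {0..Suc j}" by (rule imageE)
      have "cut f m c L G i p \<le> ?m p" using i by (intro Max_ge) auto
      moreover have "cut f m c L G i c - cut f m c L G i p < \<rho> * d * norm (p - c)"
        using i new[of i] Suc by simp
      ultimately have "?m c - ?m p < \<rho> * d * norm (p - c)" using i by linarith
      then show ?thesis using Suc Full_Memory by (simp add: Let_def)
    next
      case Two_Cut
      then show ?thesis using Suc max_less[OF new agg] by (simp add: Let_def s_def)
    next
      case General
      have "M (Suc j) c - M (Suc j) p \<le> l\<^sub>M * norm (p - c)"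
        using lipschitz_onD[OF user_model(1)[OF General], of j c p] k Suc p d_pos
        by (auto simp: in_S dist_norm norm_minus_commute)
      also have "\<dots> < \<rho> * d * norm (p - c)" using lM p by simp
      finally have "M (Suc j) c - M (Suc j) p < \<rho> * d * norm (p - c)" .
      from max_less[OF this max_less[OF new agg]] show ?thesis
        using Suc General by (simp add: Let_def s_def)
    qed
  qed
qed

lemma inner_iterate_near: "k \<le> n \<Longrightarrow> norm (L k - c) < d"
proof (induction k rule: less_induct)
  case (less k)
  show ?case
  proof (cases k)
    case 0
    then show ?thesis using d_pos start by simp
  next
    case (Suc j)
    then have j: "j < n" using less.prems by simp
    have "norm (L (Suc j) - c) < d"
    proof (rule prox_step_in_ball[OF model_convex[OF j] rho_pos d_pos])
      show "model j (L (Suc j)) + \<rho> * (norm (L (Suc j) - c))\<^sup>2 \<le> model j c"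
        using agg_subgradient[OF j, of c] by (simp add: dot_square_norm norm_minus_commute)
      show "model j c - model j p < \<rho> * d * norm (p - c)"
        if "0 < norm (p - c)" "norm (p - c) < d" for p
        using model_drop[OF j _ that] less Suc by simp
    qed
    then show ?thesis using Suc by simp
  qed
qed

lemma model_minorant: "k < n \<Longrightarrow> x \<in> U \<Longrightarrow> model k x \<le> F x"
proof (induction k arbitrary: x)
  case 0
  then show ?case using cut_minorant[OF inner_iterate_near slope, of 0 x] start by simp
next
  case (Suc j)
  have new: "cut f m c L G i x \<le> F x" if "i \<le> Suc j" for i
    unfolding cut_def using cut_minorant[OF inner_iterate_near slope, of i x] that Suc.prems by simp
  have agg: "model j (L (Suc j)) + \<rho> * ((c - L (Suc j)) \<bullet> (x - L (Suc j))) \<le> F x"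
    using agg_subgradient[of j x] Suc.IH[of x] Suc.prems by simp
  show ?case
  proof (cases mt)
    case General
    then show ?thesis using new[of "Suc j"] agg user_model(3)[OF General, of j x] Suc.prems
      by (simp add: Let_def)
  qed (use new agg in \<open>auto simp: Let_def intro!: Max.boundedI\<close>)
qed

text \<open>The decrease predicted by the \<open>k\<close>-th proximal subproblem. It measures how far \<open>c\<close> is from being
  stationary.\<close>

definition gap :: "nat \<Rightarrow> real" where
  "gap k = f c - model k (L (Suc k)) - \<rho> / 2 * (norm (L (Suc k) - c))\<^sup>2"

lemma center_in_U: "c \<in> U"
  using in_U[of c] d_pos by simp

lemma prox_decrease: "k < n \<Longrightarrow> model k (L (Suc k)) + \<rho> * (norm (L (Suc k) - c))\<^sup>2 \<le> f c"
  using agg_subgradient[of k c] model_minorant[OF _ center_in_U, of k]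
  by (simp add: dot_square_norm norm_minus_commute)

text \<open>Since the model minorizes \<open>F\<close>, the aggregate slope is an approximate subgradient at \<open>c\<close>. Its
  norm and its accuracy are the two parts of the gap.\<close>

lemma small_gap_stationary:
  assumes k: "k < n" and \<eta>: "0 < \<eta>" and gap\<eta>: "gap k \<le> \<eta>\<^sup>2 / (2 * \<rho>)" and gap\<epsilon>: "gap k \<le> \<epsilon>"
  shows "stationary_point f m S \<eta> \<epsilon> c"
proof -
  let ?L = "L (Suc k)"
  let ?s = "\<rho> *\<^sub>R (c - ?L)" and ?N = "(norm (?L - c))\<^sup>2"
  have e: "0 \<le> f c - model k ?L - \<rho> * ?N" using prox_decrease[OF k] by simp
  have "\<rho> / 2 * ?N \<le> gap k" using e by (simp add: gap_def)
  then have "\<rho> / 2 * ?N \<le> \<eta>\<^sup>2 / (2 * \<rho>)" using gap\<eta> by simp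
  then have "2 * \<rho> * (\<rho> / 2 * ?N) \<le> 2 * \<rho> * (\<eta>\<^sup>2 / (2 * \<rho>))"
    using rho_pos by (intro mult_left_mono) auto
  then have "(\<rho> * norm (?L - c))\<^sup>2 \<le> \<eta>\<^sup>2"
    using rho_pos by (simp add: power2_eq_square mult_ac)
  then have "\<rho> * norm (?L - c) \<le> \<eta>" by (rule power2_le_imp_le) (use \<eta> in simp)
  then have "norm ?s \<le> \<eta>" using rho_pos by (simp add: norm_minus_commute)
  moreover have "?s \<in> eps_subdiff f m S \<epsilon> c"
    unfolding eps_subdiff_def
  proof (intro CollectI ballI)
    fix y assume y: "y \<in> U"
    have "model k ?L + ?s \<bullet> (y - ?L) \<le> F y"
      using agg_subgradient[OF k, of y] model_minorant[OF k y] by simp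
    moreover have "?s \<bullet> (y - ?L) = ?s \<bullet> (y - c) + \<rho> * ?N"
    proof -
      have "?s \<bullet> (y - ?L) = ?s \<bullet> (y - c) + ?s \<bullet> (c - ?L)"
        by (simp add: inner_diff_right)
      then show ?thesis by (simp add: dot_square_norm norm_minus_commute)
    qed
    moreover have "f c - model k ?L - \<rho> * ?N \<le> \<epsilon>"
    proof -
      have "gap k = (f c - model k ?L - \<rho> * ?N) + \<rho> / 2 * ?N" by (simp add: gap_def)
      moreover have "0 \<le> \<rho> / 2 * ?N" using rho_pos by simp
      ultimately show ?thesis using gap\<epsilon> by linarith
    qed
    ultimately show "f y \<ge> f c + ?s \<bullet> (y - c) - m / 2 * (norm (y - c))\<^sup>2 - \<epsilon>" by linarith
  qed
  moreover have "c \<in> interior S" using in_interior[of c] d_pos by simp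
  ultimately show ?thesis unfolding stationary_point_def by blast
qed

lemma descent_amount:
  assumes k: "k < n" and test: "descent_test f m \<beta> c (model k) (L (Suc k))"
  shows "f (L (Suc k)) \<le> f c - \<beta> * gap k" and "0 \<le> gap k"
proof -
  have "0 \<le> \<rho> / 2 * (norm (L (Suc k) - c))\<^sup>2" using rho_pos by simp
  then have "gap k \<le> f c - model k (L (Suc k))" by (simp add: gap_def)
  then have "\<beta> * gap k \<le> \<beta> * (f c - model k (L (Suc k)))" using beta by simp
  moreover have "0 \<le> m / 2 * (norm (L (Suc k) - c))\<^sup>2" using m_pos by simp
  ultimately show "f (L (Suc k)) \<le> f c - \<beta> * gap k"
    using test unfolding descent_test_def by linarith
  show "0 \<le> gap k"
    using prox_decrease[OF k] \<open>0 \<le> \<rho> / 2 * _\<close> by (simp add: gap_def)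
qed

lemma gap_0: "0 < n \<Longrightarrow> gap 0 \<le> \<rho> * d\<^sup>2 / 2"
proof -
  assume n: "0 < n"
  let ?x = "L (Suc 0) - c"
  have "norm (G 0) < \<rho> * d" using cut_slope[OF inner_iterate_near slope, of 0] n by simp
  then have "norm (G 0) * norm ?x \<le> \<rho> * d * norm ?x" by (intro mult_right_mono) auto
  moreover have "- (G 0 \<bullet> ?x) \<le> norm (G 0) * norm ?x"
    using norm_cauchy_schwarz[of "- G 0" ?x] by simp
  moreover have "0 \<le> \<rho> / 2 * (norm ?x - d)\<^sup>2" using rho_pos by simp
  then have "\<rho> * d * norm ?x \<le> \<rho> / 2 * (norm ?x)\<^sup>2 + \<rho> * d\<^sup>2 / 2"
    by (simp add: power2_eq_square field_simps)
  ultimately show ?thesis by (simp add: gap_def start)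
qed

text \<open>The two lower bounds that make a null step productive. The full-memory model contains no
  aggregate function, but it dominates its predecessor, of which the aggregate is a minorant.\<close>

lemma next_model_ge:
  assumes k: "Suc k < n"
  shows "model k (L (Suc k)) + \<rho> * ((c - L (Suc k)) \<bullet> (x - L (Suc k))) \<le> model (Suc k) x"
    and "F (L (Suc k)) + G (Suc k) \<bullet> (x - L (Suc k)) \<le> model (Suc k) x"
proof -
  have "model k (L (Suc k)) + \<rho> * ((c - L (Suc k)) \<bullet> (x - L (Suc k))) \<le> model (Suc k) x
      \<and> cut f m c L G (Suc k) x \<le> model (Suc k) x"
  proof (cases mt)
    case Full_Memory
    let ?m = "Max ((\<lambda>i. cut f m c L G i x) ` {0..Suc k})"
    have "model k x \<le> ?m"
    proof (cases k)
      case 0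
      then have "model k x = cut f m c L G 0 x" by (simp add: cut_def start)
      then show ?thesis by (auto intro!: Max_ge)
    next
      case (Suc j)
      then show ?thesis using Full_Memory by (auto simp: Let_def intro!: Max_mono)
    qed
    moreover have "cut f m c L G (Suc k) x \<le> ?m" by (auto intro!: Max_ge)
    moreover have "model (Suc k) x = ?m" using Full_Memory by (simp add: Let_def)
    ultimately show ?thesis using agg_subgradient[of k x] k by simp
  qed (auto simp: Let_def)
  then show "model k (L (Suc k)) + \<rho> * ((c - L (Suc k)) \<bullet> (x - L (Suc k))) \<le> model (Suc k) x"
    "F (L (Suc k)) + G (Suc k) \<bullet> (x - L (Suc k)) \<le> model (Suc k) x"
    by (simp_all add: cut_def)
qed

text \<open>A failed test means that the model was too optimistic at the new point by at least a fixed
  fraction of the gap. The new cut corrects this, which raises the optimal value of the next subproblem.\<close>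

lemma gap_null_step:
  assumes k: "Suc k < n" and g: "0 \<le> gap k" "gap k \<le> \<rho> * d\<^sup>2 / 2"
  shows "gap (Suc k) \<le> gap k - (1 - \<beta>)\<^sup>2 / (8 * \<rho> * d\<^sup>2) * (gap k)\<^sup>2"
proof -
  let ?L = "L (Suc k)"
  \<comment> \<open>The weight \<open>\<theta>\<close> maximizes the gain \<open>\<theta> * a - \<theta>\<^sup>2 * H\<^sup>2 / (2 * \<rho>)\<close>. It is at most one because the
    gap never exceeds its initial bound.\<close>
  define a where "a = (1 - \<beta>) * gap k"
  define H where "H = 2 * (\<rho> * d)"
  define \<theta> where "\<theta> = a / (4 * \<rho> * d\<^sup>2)"
  have a0: "0 \<le> a" using beta g by (simp add: a_def)
  have "a \<le> 1 * gap k" unfolding a_def using beta g by (intro mult_right_mono) auto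
  then have a1: "a \<le> \<rho> * d\<^sup>2 / 2" using g by simp
  have pos: "0 < \<rho> * d\<^sup>2" using rho_pos d_pos by simp
  have \<theta>: "0 \<le> \<theta>" "\<theta> \<le> 1" unfolding \<theta>_def using a0 a1 pos by (auto simp: field_simps)
  \<comment> \<open>The failed test makes the new cut exceed the old model at \<open>?L\<close> by at least \<open>a\<close>.\<close>
  have "f c - F ?L < \<beta> * (f c - model k ?L)"
    using null_step[OF k] by (simp add: descent_test_def)
  then have "(1 - \<beta>) * (f c - model k ?L) \<le> F ?L - model k ?L" by (simp add: algebra_simps)
  moreover have "(1 - \<beta>) * gap k \<le> (1 - \<beta>) * (f c - model k ?L)"
    using beta rho_pos by (intro mult_left_mono) (auto simp: gap_def)
  ultimately have "model k ?L + a \<le> F ?L" by (simp add: a_def)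
  then have new: "model k ?L + a + G (Suc k) \<bullet> (x - ?L) \<le> model (Suc k) x" for x
    using next_model_ge(2)[OF k, of x] by linarith
  have "norm (G (Suc k)) < \<rho> * d" using cut_slope[OF inner_iterate_near slope, of "Suc k"] k by simp
  moreover have "norm (\<rho> *\<^sub>R (c - ?L)) \<le> \<rho> * d"
    using inner_iterate_near[of "Suc k"] k rho_pos by (simp add: norm_minus_commute)
  ultimately have "norm (G (Suc k) - \<rho> *\<^sub>R (c - ?L)) \<le> H"
    unfolding H_def using norm_triangle_ineq4[of "G (Suc k)" "\<rho> *\<^sub>R (c - ?L)"] by linarith
  from two_cut_prox_gain[OF rho_pos \<theta> next_model_ge(1)[OF k] new this, of "L (Suc (Suc k))"]
  have "gap (Suc k) \<le> gap k - (\<theta> * a - \<theta>\<^sup>2 * H\<^sup>2 / (2 * \<rho>))" by (simp add: gap_def)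
  also have "\<theta> * a - \<theta>\<^sup>2 * H\<^sup>2 / (2 * \<rho>) = a\<^sup>2 / (8 * \<rho> * d\<^sup>2)"
    unfolding \<theta>_def H_def using rho_pos d_pos by (simp add: field_simps power2_eq_square)
  finally show ?thesis by (simp add: a_def power_mult_distrib)
qed

text \<open>The recursion \<open>g' \<le> g - q * g\<^sup>2\<close> makes \<open>1 / g\<close> grow by at least \<open>q\<close> per null step. A call at a
  non-stationary centre therefore ends after a number of steps inversely proportional to the
  smallest gap that it may meet.\<close>

lemma inner_iterations_le:
  assumes \<sigma>: "0 < \<sigma>" and gap: "\<And>k. k < n \<Longrightarrow> \<sigma> < gap k"
  shows "real n \<le> 1 + 8 * \<rho> * d\<^sup>2 / ((1 - \<beta>)\<^sup>2 * \<sigma>)"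
proof (cases n)
  case 0
  then show ?thesis using \<sigma> rho_pos beta by simp
next
  case (Suc j)
  define q where "q = (1 - \<beta>)\<^sup>2 / (8 * \<rho> * d\<^sup>2)"
  have q: "0 < q" unfolding q_def using beta rho_pos d_pos by simp
  have pos: "0 < gap k" if "k < n" for k using gap[OF that] \<sigma> by linarith
  have "gap k \<le> \<rho> * d\<^sup>2 / 2 \<and> q * real k \<le> 1 / gap k" if "k < n" for k
    using that
  proof (induction k)
    case 0
    then show ?case using gap_0 pos[of 0] by (simp add: less_imp_le)
  next
    case (Suc k)
    let ?g = "gap k" and ?g' = "gap (Suc k)"
    have g: "0 < ?g" "0 < ?g'" and IH: "?g \<le> \<rho> * d\<^sup>2 / 2" "q * real k \<le> 1 / ?g"
      using pos[of k] pos[of "Suc k"] Suc by auto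
    have dec: "?g' \<le> ?g - q * ?g\<^sup>2"
      using gap_null_step[OF Suc.prems _ IH(1)] g by (simp add: q_def)
    have "0 \<le> q * ?g\<^sup>2" using q by simp
    then have le: "?g' \<le> ?g" using dec by linarith
    have "q * ?g * ?g' \<le> q * ?g * ?g" using le q g by (intro mult_left_mono) auto
    then have "q * ?g * ?g' + ?g' \<le> ?g" using dec by (simp add: power2_eq_square algebra_simps)
    then have "1 / ?g + q \<le> 1 / ?g'" using g by (simp add: field_simps)
    then show ?case using IH le by (simp add: algebra_simps)
  qed
  from this[of j] Suc have "q * real j \<le> 1 / gap j" by simp
  also have "\<dots> \<le> 1 / \<sigma>" using gap[of j] Suc \<sigma> by (simp add: frac_le)
  finally have "q * real j \<le> 1 / \<sigma>" .
  from divide_right_mono[OF this, of q] have "real j \<le> 1 / \<sigma> / q" using q by simp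
  then show ?thesis using Suc by (simp add: q_def field_simps)
qed

end

section \<open>Complexity of the whole method\<close>

locale bundle_method =
  fixes f :: "'a::real_inner \<Rightarrow> real" and m l d \<rho> \<beta> f\<^sub>0 :: real and S :: "'a set"
  assumes m_pos: "0 < m"
    and weak: "\<And>U. U \<subseteq> S \<Longrightarrow> convex U \<Longrightarrow> weakly_convex_on m U f"
    and lip: "lipschitz_on l S f"
    and nonneg: "\<And>x. x \<in> S \<Longrightarrow> 0 \<le> f x"
    and d_pos: "0 < d"
    and ball_sub: "\<And>x. x \<in> S \<Longrightarrow> f x \<le> f\<^sub>0 \<Longrightarrow> ball x d \<subseteq> interior S"
    and rho: "l + m * d < \<rho> * d"
    and beta: "0 < \<beta>" "\<beta> < 1"
begin

lemma prox_callI: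
  assumes "x \<in> S" "f x \<le> f\<^sub>0" "l\<^sub>M < \<rho> * d" "prox_descent_steps mt f m l\<^sub>M S \<beta> \<rho> x n L G M"
  shows "prox_call f m l d \<rho> S x mt l\<^sub>M \<beta> n L G M"
  by unfold_locales (use assms m_pos weak lip d_pos ball_sub rho beta in auto)

lemma execution_steps:
  assumes "bundle_execution mt f m l\<^sub>M S \<beta> \<rho> K0 T K n L G M" "t \<le> T"
  shows "prox_descent_steps mt f m l\<^sub>M S \<beta> \<rho> (K t) (n t) (L t) (G t) (M t)"
  using assms unfolding bundle_execution_def prox_descent_returns_def by (cases "t = T") auto

lemma execution_returns:
  assumes "bundle_execution mt f m l\<^sub>M S \<beta> \<rho> K0 T K n L G M" "t < T"
  obtains k where "n t = Suc k" "K (Suc t) = L t (Suc k)"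
    "descent_test f m \<beta> (K t) (bundle_model mt f m \<rho> (K t) (L t) (G t) (M t) k) (L t (Suc k))"
proof -
  have ret: "prox_descent_returns mt f m l\<^sub>M S \<beta> \<rho> (K t) (n t) (L t) (G t) (M t) (K (Suc t))"
    using assms by (simp add: bundle_execution_def)
  then obtain k where "n t = Suc k" unfolding prox_descent_returns_def by (blast dest: gr0_implies_Suc)
  with ret show ?thesis using that[of k] by (simp add: prox_descent_returns_def)
qed

lemma outer_iterate_in_sublevel:
  assumes exec: "bundle_execution mt f m l\<^sub>M S \<beta> \<rho> K0 T K n L G M"
    and lM: "l\<^sub>M < \<rho> * d" and K0: "K0 \<in> S" "f K0 \<le> f\<^sub>0"
  shows "t \<le> T \<Longrightarrow> K t \<in> S \<and> f (K t) \<le> f\<^sub>0"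
proof (induction t)
  case 0
  then show ?case using exec K0 by (simp add: bundle_execution_def)
next
  case (Suc t)
  then have t: "t < T" and IH: "K t \<in> S" "f (K t) \<le> f\<^sub>0" by auto
  interpret prox_call f m l d \<rho> S "K t" mt l\<^sub>M \<beta> "n t" "L t" "G t" "M t"
    by (rule prox_callI[OF IH lM execution_steps[OF exec]]) (use t in simp)
  obtain k where k: "n t = Suc k" "K (Suc t) = L t (Suc k)"
    "descent_test f m \<beta> (K t) (model k) (L t (Suc k))"
    by (rule execution_returns[OF exec t])
  have "f (L t (Suc k)) \<le> f (K t) - \<beta> * gap k" "0 \<le> \<beta> * gap k"
    using descent_amount[OF _ k(3)] k(1) beta by simp_all
  then show ?case using inner_iterate_near[of "Suc k"] in_S k IH by simp
qed

lemma inner_iterate_in_interior: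
  assumes exec: "bundle_execution mt f m l\<^sub>M S \<beta> \<rho> K0 T K n L G M"
    and lM: "l\<^sub>M < \<rho> * d" and K0: "K0 \<in> S" "f K0 \<le> f\<^sub>0" and t: "t \<le> T" and k: "k \<le> n t"
  shows "L t k \<in> interior S"
proof -
  have Kt: "K t \<in> S" "f (K t) \<le> f\<^sub>0" using outer_iterate_in_sublevel[OF exec lM K0 t] by auto
  interpret prox_call f m l d \<rho> S "K t" mt l\<^sub>M \<beta> "n t" "L t" "G t" "M t"
    by (rule prox_callI[OF Kt lM execution_steps[OF exec t]])
  show ?thesis using inner_iterate_near[OF k] by (rule in_interior)
qed

text \<open>Number of calls times number of steps per call. All gaps exceed \<open>\<sigma>\<close>, so each completed call
  lowers the nonnegative function \<open>f\<close> by \<open>\<beta> * \<sigma>\<close>. The last call may be unfinished.\<close>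

lemma total_iterations_le:
  assumes exec: "bundle_execution mt f m l\<^sub>M S \<beta> \<rho> K0 T K n L G M"
    and lM: "l\<^sub>M < \<rho> * d" and K0: "K0 \<in> S" "f K0 \<le> f\<^sub>0"
    and \<eta>: "0 < \<eta>" and \<epsilon>: "0 < \<epsilon>"
    and nonstationary: "\<And>t. t \<le> T \<Longrightarrow> \<not> stationary_point f m S \<eta> \<epsilon> (K t)"
    and \<sigma>: "0 < \<sigma>" "\<sigma> \<le> \<epsilon>" "\<sigma> \<le> \<eta>\<^sup>2 / (2 * \<rho>)"
  shows "real (\<Sum>t\<le>T. n t)
    \<le> (1 + f\<^sub>0 / (\<beta> * \<sigma>)) * (1 + 8 * \<rho> * d\<^sup>2 / ((1 - \<beta>)\<^sup>2 * \<sigma>))"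
proof -
  let ?N = "1 + 8 * \<rho> * d\<^sup>2 / ((1 - \<beta>)\<^sup>2 * \<sigma>)"
  have call: "real (n t) \<le> ?N
      \<and> (t < T \<longrightarrow> f (K (Suc t)) \<le> f (K t) - \<beta> * \<sigma>)" if t: "t \<le> T" for t
  proof -
    have Kt: "K t \<in> S" "f (K t) \<le> f\<^sub>0" using outer_iterate_in_sublevel[OF exec lM K0 t] by auto
    interpret prox_call f m l d \<rho> S "K t" mt l\<^sub>M \<beta> "n t" "L t" "G t" "M t"
      by (rule prox_callI[OF Kt lM execution_steps[OF exec t]])
    have gap: "\<sigma> < gap k" if "k < n t" for k
    proof (rule ccontr)
      assume "\<not> \<sigma> < gap k"
      then have "gap k \<le> \<eta>\<^sup>2 / (2 * \<rho>)" "gap k \<le> \<epsilon>" using \<sigma> by linarith+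
      from small_gap_stationary[OF that \<eta> this] nonstationary[OF t] show False by contradiction
    qed
    have "f (K (Suc t)) \<le> f (K t) - \<beta> * \<sigma>" if tT: "t < T"
    proof -
      obtain k where k: "n t = Suc k" "K (Suc t) = L t (Suc k)"
        "descent_test f m \<beta> (K t) (model k) (L t (Suc k))"
        by (rule execution_returns[OF exec tT])
      have "\<beta> * \<sigma> \<le> \<beta> * gap k" using gap[of k] k(1) beta by simp
      then show ?thesis using descent_amount(1)[OF _ k(3)] k by simp
    qed
    then show ?thesis using inner_iterations_le[OF \<sigma>(1) gap] by simp
  qed
  have "f (K t) \<le> f\<^sub>0 - real t * (\<beta> * \<sigma>)" if "t \<le> T" for t
    using that
  proof (induction t)
    case 0
    then show ?case using exec K0 by (simp add: bundle_execution_def)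
  next
    case (Suc t)
    then have "f (K (Suc t)) \<le> f (K t) - \<beta> * \<sigma>" using call[of t] by simp
    then show ?case using Suc by (simp add: algebra_simps)
  qed
  from this[of T] have "real T * (\<beta> * \<sigma>) \<le> f\<^sub>0"
    using nonneg[of "K T"] outer_iterate_in_sublevel[OF exec lM K0, of T] by simp
  then have T: "real T \<le> f\<^sub>0 / (\<beta> * \<sigma>)" using beta \<sigma> by (simp add: pos_le_divide_eq)
  have "0 \<le> ?N" using call[of 0] by (meson le0 of_nat_0_le_iff order_trans)
  have "real (\<Sum>t\<le>T. n t) = (\<Sum>t\<le>T. real (n t))" by simp
  also have "\<dots> \<le> (\<Sum>t\<le>T. ?N)" by (rule sum_mono) (use call in simp)
  also have "\<dots> = (1 + real T) * ?N" by simp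
  also have "\<dots> \<le> (1 + f\<^sub>0 / (\<beta> * \<sigma>)) * ?N" using T \<open>0 \<le> ?N\<close> by (intro mult_right_mono) auto
  finally show ?thesis .
qed

text \<open>The bound \<open>total_iterations_le\<close> at \<open>\<sigma> = \<kappa>\<close>, that is, for \<open>\<tau> = 1\<close>. The final \<open>+ 1\<close> makes the
  comparison in \<open>stationary_point_reached\<close> strict.\<close>

definition rate :: real where
  "rate = (let \<kappa> = min 1 (1 / (2 * \<rho>))
     in (1 + f\<^sub>0 / (\<beta> * \<kappa>)) * (1 + 8 * \<rho> * d\<^sup>2 / ((1 - \<beta>)\<^sup>2 * \<kappa>)) + 1)"

text \<open>The threshold \<open>\<sigma> = \<kappa> * \<tau>\<close> with \<open>\<tau> = min (\<eta>\<^sup>2) \<epsilon>\<close> serves both tolerances at once, and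
  \<open>1 / \<tau>\<^sup>2\<close> is the maximum of \<open>1 / \<eta> ^ 4\<close> and \<open>1 / \<epsilon>\<^sup>2\<close>.\<close>

lemma stationary_point_reached:
  assumes exec: "bundle_execution mt f m l\<^sub>M S \<beta> \<rho> K0 T K n L G M"
    and lM: "l\<^sub>M < \<rho> * d" and K0: "K0 \<in> S" "f K0 \<le> f\<^sub>0"
    and \<eta>: "0 < \<eta>" "\<eta> \<le> 1" and \<epsilon>: "0 < \<epsilon>" "\<epsilon> \<le> 1"
    and many: "rate * max (1 / \<eta> ^ 4) (1 / \<epsilon>\<^sup>2) \<le> real (\<Sum>t\<le>T. n t)"
  shows "\<exists>t\<le>T. stationary_point f m S \<eta> \<epsilon> (K t)"
proof (rule ccontr)
  assume none: "\<not> ?thesis"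
  have rho_pos: "0 < \<rho>"
    using outer_iterate_in_sublevel[OF exec lM K0, of 0] prox_callI[OF _ _ lM execution_steps[OF exec]]
      prox_center.rho_pos[OF prox_call.axioms(1)] by blast
  define \<kappa> where "\<kappa> = min 1 (1 / (2 * \<rho>))"
  define \<tau> where "\<tau> = min (\<eta>\<^sup>2) \<epsilon>"
  define a where "a = f\<^sub>0 / (\<beta> * \<kappa>)"
  define b where "b = 8 * \<rho> * d\<^sup>2 / ((1 - \<beta>)\<^sup>2 * \<kappa>)"
  have \<kappa>: "0 < \<kappa>" "\<kappa> \<le> 1" "\<kappa> \<le> 1 / (2 * \<rho>)" using rho_pos by (auto simp: \<kappa>_def)
  have \<tau>: "0 < \<tau>" "\<tau> \<le> \<eta>\<^sup>2" "\<tau> \<le> \<epsilon>" "\<tau> \<le> 1" using \<eta> \<epsilon> by (auto simp: \<tau>_def)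
  have "0 \<le> f\<^sub>0" using nonneg[OF K0(1)] K0(2) by linarith
  then have ab: "0 \<le> a" "0 \<le> b" using \<kappa> beta rho_pos by (auto simp: a_def b_def)
  have rate: "rate = (1 + a) * (1 + b) + 1" by (simp add: rate_def \<kappa>_def a_def b_def Let_def)
  have "\<kappa> * \<tau> \<le> 1 * \<epsilon>" using \<kappa> \<tau> by (intro mult_mono) auto
  moreover have "\<kappa> * \<tau> \<le> (1 / (2 * \<rho>)) * \<eta>\<^sup>2" using \<kappa> \<tau> rho_pos by (intro mult_mono) auto
  ultimately have "real (\<Sum>t\<le>T. n t)
      \<le> (1 + f\<^sub>0 / (\<beta> * (\<kappa> * \<tau>))) * (1 + 8 * \<rho> * d\<^sup>2 / ((1 - \<beta>)\<^sup>2 * (\<kappa> * \<tau>)))"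
    by (intro total_iterations_le[OF exec lM K0 \<eta>(1) \<epsilon>(1)]) (use none \<kappa> \<tau> in auto)
  also have "\<dots> = (1 + a / \<tau>) * (1 + b / \<tau>)" by (simp add: a_def b_def mult.assoc)
  also have "\<dots> \<le> ((1 + a) / \<tau>) * ((1 + b) / \<tau>)"
    using ab \<tau> by (intro mult_mono) (auto simp: field_simps)
  also have "\<dots> = (1 + a) * (1 + b) * (1 / \<tau>\<^sup>2)" by (simp add: power2_eq_square)
  also have "\<dots> < rate * (1 / \<tau>\<^sup>2)"
    using \<tau> rate by (intro mult_strict_right_mono) auto
  also have "\<dots> \<le> rate * max (1 / \<eta> ^ 4) (1 / \<epsilon>\<^sup>2)"
  proof (rule mult_left_mono)
    show "1 / \<tau>\<^sup>2 \<le> max (1 / \<eta> ^ 4) (1 / \<epsilon>\<^sup>2)" by (simp add: \<tau>_def min_def)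
    show "0 \<le> rate" using rate ab by simp
  qed
  finally show False using many by simp
qed

lemma rate_pos: "0 \<le> f\<^sub>0 \<Longrightarrow> 0 < \<rho> \<Longrightarrow> 0 < rate"
  using beta by (simp add: rate_def Let_def add_nonneg_pos)

end

section \<open>Complex matrices and their largest singular value\<close>

lemma bounded_bilinear_matrix_vector: "bounded_bilinear ((*v) :: complex^'n^'m \<Rightarrow> _)"
proof -
  have "bilinear ((*v) :: complex^'n^'m \<Rightarrow> _)"
    unfolding bilinear_def
    by (auto intro!: linearI simp: vec_eq_iff matrix_vector_mult_def algebra_simps sum.distrib
        scaleR_sum_right)
  then show ?thesis by (simp add: bilinear_conv_bounded_bilinear)
qed

lemma bounded_bilinear_matrix_matrix:
  "bounded_bilinear ((**) :: 'a::{euclidean_space,real_algebra_1}^'n^'m \<Rightarrow> 'a^'p^'n \<Rightarrow> _)"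
proof -
  have "bilinear ((**) :: 'a::{euclidean_space,real_algebra_1}^'n^'m \<Rightarrow> 'a^'p^'n \<Rightarrow> _)"
    unfolding bilinear_def
    by (auto intro!: linearI simp: vec_eq_iff matrix_matrix_mult_def algebra_simps sum.distrib
        scaleR_sum_right)
  then show ?thesis by (simp add: bilinear_conv_bounded_bilinear)
qed

lemma inner_conj_transpose: "(M *v x) \<bullet> y = x \<bullet> (conj_transpose M *v y)"
proof -
  have *: "((a::complex) * b) \<bullet> c = b \<bullet> (cnj a * c)" for a b c
    by (simp add: inner_complex_def algebra_simps)
  have "(M *v x) \<bullet> y = (\<Sum>i\<in>UNIV. \<Sum>j\<in>UNIV. x $ j \<bullet> (cnj (M $ i $ j) * y $ i))"
    by (simp add: inner_vec_def matrix_vector_mult_def inner_sum_left *)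
  also have "\<dots> = (\<Sum>j\<in>UNIV. \<Sum>i\<in>UNIV. x $ j \<bullet> (cnj (M $ i $ j) * y $ i))"
    by (rule sum.swap)
  also have "\<dots> = x \<bullet> (conj_transpose M *v y)"
    by (simp add: inner_vec_def matrix_vector_mult_def conj_transpose_def transpose_def
        inner_sum_right)
  finally show ?thesis .
qed

lemma inner_gram: "((conj_transpose M ** M) *v x) \<bullet> y = (M *v x) \<bullet> (M *v y)"
  by (metis inner_commute inner_conj_transpose matrix_vector_mul_assoc)

lemma inner_vector_smult: "((z::complex) *s v) \<bullet> (w *s v) = (z \<bullet> w) * (v \<bullet> v)"
  by (simp add: inner_vec_def sum_distrib_left inner_complex_def algebra_simps)

text \<open>The Gram matrix is Hermitian: testing the eigenvalue equation against \<open>\<i> v\<close> isolates the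
  imaginary part of \<open>z\<close>, testing it against \<open>v\<close> the real part.\<close>

lemma eigenvalue_gram_real:
  fixes M :: "complex^'n^'m"
  assumes v: "v \<noteq> 0" and eig: "(conj_transpose M ** M) *v v = z *s v"
  shows "z = complex_of_real (Re z)" and "Re z * (norm v)\<^sup>2 = (norm (M *v v))\<^sup>2"
proof -
  have "(z *s v) \<bullet> (\<i> *s v) = (M *v v) \<bullet> (M *v (\<i> *s v))"
    unfolding eig[symmetric] by (rule inner_gram)
  also have "\<dots> = (1 *s (M *v v)) \<bullet> (\<i> *s (M *v v))"
    by (simp add: vector_scalar_commute)
  also have "\<dots> = 0" unfolding inner_vector_smult by (simp add: inner_complex_def)
  finally have "Im z * (v \<bullet> v) = 0" unfolding inner_vector_smult by (simp add: inner_complex_def)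
  then have "Im z = 0" using v by simp
  then show "z = complex_of_real (Re z)" by (simp add: complex_eq_iff)
  have "(z *s v) \<bullet> (1 *s v) = (M *v v) \<bullet> (M *v v)"
    unfolding eig[symmetric] by (simp add: inner_gram)
  then show "Re z * (norm v)\<^sup>2 = (norm (M *v v))\<^sup>2"
    unfolding inner_vector_smult by (simp add: inner_complex_def power2_norm_eq_inner)
qed

lemma scaleR_eq_smult: "r *\<^sub>R (v :: complex^'n) = complex_of_real r *s v"
proof (rule vec_eq_iff[THEN iffD2, rule_format])
  fix i
  have "(r *\<^sub>R v) $ i = complex_of_real r * v $ i"
    by (subst vector_scaleR_component) (rule scaleR_conv_of_real)
  then show "(r *\<^sub>R v) $ i = (complex_of_real r *s v) $ i" by simp
qed

text \<open>Eigenvectors of a Hermitian matrix for distinct eigenvalues are orthogonal, so the dimension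
  bounds their number. Finiteness gives the maximum in the definition of \<open>sigma_max\<close> its meaning.\<close>

lemma finite_eigenvalues_gram:
  fixes M :: "complex^'n^'m"
  shows "finite {z. eigenvalue (conj_transpose M ** M) z}" (is "finite ?E")
proof -
  let ?H = "conj_transpose M ** M"
  have "\<exists>v. v \<noteq> 0 \<and> ?H *v v = z *s v" if "z \<in> ?E" for z
    using that by (simp add: eigenvalue_def)
  then obtain w where w: "w z \<noteq> 0" "?H *v w z = z *s w z" if "z \<in> ?E" for z by metis
  have scale: "?H *v w z = Re z *\<^sub>R w z" if "z \<in> ?E" for z
    using w[OF that] eigenvalue_gram_real(1)[OF w[OF that]] scaleR_eq_smult by metis
  have orth: "w z \<bullet> w z' = 0" if z: "z \<in> ?E" "z' \<in> ?E" "z \<noteq> z'" for z z'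
  proof -
    have "(?H *v w z) \<bullet> w z' = (?H *v w z') \<bullet> w z"
      unfolding inner_gram by (rule inner_commute)
    then have "(Re z - Re z') * (w z \<bullet> w z') = 0"
      unfolding scale[OF z(1)] scale[OF z(2)] by (simp add: inner_commute algebra_simps)
    moreover have "Re z \<noteq> Re z'"
      using z eigenvalue_gram_real(1)[OF w[OF z(1)]] eigenvalue_gram_real(1)[OF w[OF z(2)]] by metis
    ultimately show ?thesis by simp
  qed
  have "inj_on w ?E"
  proof (rule inj_onI, rule ccontr)
    fix z z' assume "z \<in> ?E" "z' \<in> ?E" "w z = w z'" "z \<noteq> z'"
    then show False using orth[of z z'] w(1)[of z'] by simp
  qed
  moreover have "finite (w ` ?E)"
    by (rule pairwise_orthogonal_imp_finite)
       (use orth in \<open>auto simp: pairwise_def orthogonal_def\<close>)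
  ultimately show ?thesis by (rule finite_imageD[rotated])
qed

text \<open>A unit vector at which the norm of \<open>M *v x\<close> is largest is a critical point of the
  nonnegative quadratic form \<open>s\<^sup>2 * norm x ^ 2 - norm (M *v x) ^ 2\<close>, hence an eigenvector of the
  Gram matrix.\<close>

lemma sigma_max_eq_onorm: "sigma_max M = onorm ((*v) M)"
proof -
  let ?H = "conj_transpose M ** M" and ?s = "onorm ((*v) M)"
  have bl: "bounded_linear ((*v) M)" by (rule matrix_vector_mul_bounded_linear)
  have s0: "0 \<le> ?s" using onorm_pos_le[OF bl] .
  have s: "norm (M *v x) \<le> ?s * norm x" for x using onorm[OF bl] .
  obtain e :: "complex^'a" where e: "norm e = 1" by (rule vector_choose_size[of 1]) auto
  have "continuous_on (sphere 0 1) (\<lambda>x. norm (M *v x))"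
    by (intro continuous_on_norm linear_continuous_on bl)
  then obtain v where v: "norm v = 1" "\<And>x. norm x = 1 \<Longrightarrow> norm (M *v x) \<le> norm (M *v v)"
    using continuous_attains_sup[of "sphere 0 1" "\<lambda>x. norm (M *v x)"] e by auto
  have "norm (M *v x) \<le> norm (M *v v) * norm x" for x
  proof (cases "x = 0")
    case False
    have "norm (M *v (inverse (norm x) *\<^sub>R x)) \<le> norm (M *v v)"
      by (rule v(2)) (use False in simp)
    then have "inverse (norm x) * norm (M *v x) \<le> norm (M *v v)"
      by (simp add: linear_cmul[OF bounded_linear.linear[OF bl]])
    then show ?thesis using False by (simp add: field_simps)
  qed simp
  then have "?s \<le> norm (M *v v)" by (rule onorm_le)
  then have sv: "norm (M *v v) = ?s" using s[of v] v by simp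
  have crit: "(?s\<^sup>2 *\<^sub>R v - ?H *v v) \<bullet> u = 0" for u
  proof -
    define b where "b = ?s\<^sup>2 * (v \<bullet> u) - (M *v v) \<bullet> (M *v u)"
    define q where "q = ?s\<^sup>2 * (norm u)\<^sup>2 - (norm (M *v u))\<^sup>2"
    have nonneg: "0 \<le> ?s\<^sup>2 * (norm x)\<^sup>2 - (norm (M *v x))\<^sup>2" for x
      using power_mono[OF s[of x], of 2] by (simp add: power_mult_distrib)
    have "0 \<le> 2 * t * b + t\<^sup>2 * q" for t
    proof -
      have "M *v (v + t *\<^sub>R u) = M *v v + t *\<^sub>R (M *v u)"
        by (simp add: linear_add[OF bounded_linear.linear[OF bl]]
            linear_cmul[OF bounded_linear.linear[OF bl]])
      then have "?s\<^sup>2 * (norm (v + t *\<^sub>R u))\<^sup>2 - (norm (M *v (v + t *\<^sub>R u)))\<^sup>2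
          = (?s\<^sup>2 * (norm v)\<^sup>2 - (norm (M *v v))\<^sup>2) + 2 * t * b + t\<^sup>2 * q"
        unfolding b_def q_def power2_norm_eq_inner
        by (simp add: inner_simps inner_commute algebra_simps power2_eq_square)
      then show ?thesis using nonneg[of "v + t *\<^sub>R u"] sv v by simp
    qed
    \<comment> \<open>A nonnegative quadratic that vanishes at zero has no linear term; otherwise this \<open>t\<close> would
      make it negative.\<close>
    from this[of "- b / (q + 1)"] have *: "0 \<le> 2 * (- b / (q + 1)) * b + (- b / (q + 1))\<^sup>2 * q" .
    have q: "0 \<le> q" unfolding q_def by (rule nonneg)
    have eq: "2 * (- b / (q + 1)) * b + (- b / (q + 1))\<^sup>2 * q = - (b\<^sup>2 * (q + 2)) / (q + 1)\<^sup>2"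
      using q by (simp add: field_simps power2_eq_square add_nonneg_eq_0_iff)
    have pos: "0 < (q + 1)\<^sup>2" using q by simp
    have "0 \<le> - (b\<^sup>2 * (q + 2))"
      using * unfolding eq by (simp only: pos_le_divide_eq[OF pos] mult_zero_left)
    then have "b\<^sup>2 * (q + 2) \<le> 0" by simp
    then have "b = 0" using q by (simp add: mult_le_0_iff)
    then show ?thesis by (simp add: b_def inner_diff_left inner_gram)
  qed
  have "?H *v v = ?s\<^sup>2 *\<^sub>R v" using crit[of "?s\<^sup>2 *\<^sub>R v - ?H *v v"] by simp
  also have "\<dots> = complex_of_real (?s\<^sup>2) *s v" by (rule scaleR_eq_smult)
  finally have eig: "eigenvalue ?H (complex_of_real (?s\<^sup>2))"
    unfolding eigenvalue_def using v by (intro exI[of _ v]) auto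
  have le: "sqrt (Re z) \<le> ?s" if z: "eigenvalue ?H z" for z
  proof -
    obtain w where w: "w \<noteq> 0" "?H *v w = z *s w" using z by (auto simp: eigenvalue_def)
    have "Re z * (norm w)\<^sup>2 \<le> ?s\<^sup>2 * (norm w)\<^sup>2"
      unfolding eigenvalue_gram_real(2)[OF w]
      using power_mono[OF s[of w], of 2] by (simp add: power_mult_distrib)
    then have "Re z \<le> ?s\<^sup>2" using w by simp
    then show ?thesis using s0 by (simp add: real_le_lsqrt)
  qed
  have "{sqrt (Re z) |z. eigenvalue ?H z} = (\<lambda>z. sqrt (Re z)) ` {z. eigenvalue ?H z}" by auto
  then have "Max {sqrt (Re z) |z. eigenvalue ?H z} = ?s"
    using finite_eigenvalues_gram[of M] le eig s0
    by (intro Max_eqI) (auto intro!: image_eqI[of _ _ "complex_of_real (?s\<^sup>2)"])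
  then show ?thesis by (simp add: sigma_max_def)
qed

lemma norm_mult_le_sigma_max: "norm (M *v x) \<le> sigma_max M * norm x"
  unfolding sigma_max_eq_onorm by (rule onorm[OF matrix_vector_mul_bounded_linear])

lemma sigma_max_nonneg: "0 \<le> sigma_max M"
  unfolding sigma_max_eq_onorm by (rule onorm_pos_le[OF matrix_vector_mul_bounded_linear])

lemma continuous_on_sigma_max:
  fixes F :: "'a::topological_space \<Rightarrow> complex^'n^'m"
  assumes "continuous_on S F"
  shows "continuous_on S (\<lambda>p. sigma_max (F p))"
proof -
  obtain C where C: "0 < C" "\<And>(M::complex^'n^'m) x. norm (M *v x) \<le> norm M * norm x * C"
    using bounded_bilinear.pos_bounded[OF bounded_bilinear_matrix_vector] by blast
  have le: "sigma_max M \<le> sigma_max N + C * norm (M - N)" for M N :: "complex^'n^'m"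
  proof -
    have "sigma_max M \<le> sigma_max N + sigma_max (M - N)"
      unfolding sigma_max_eq_onorm
      using onorm_triangle[OF matrix_vector_mul_bounded_linear[of N] matrix_vector_mul_bounded_linear[of "M - N"]]
      by (simp add: matrix_vector_mult_add_rdistrib[symmetric])
    moreover have "sigma_max (M - N) \<le> C * norm (M - N)"
      unfolding sigma_max_eq_onorm by (rule onorm_le) (use C(2)[of "M - N"] in \<open>simp add: mult_ac\<close>)
    ultimately show ?thesis by linarith
  qed
  have "C-lipschitz_on UNIV (sigma_max :: complex^'n^'m \<Rightarrow> real)"
  proof (rule lipschitz_onI)
    fix M N :: "complex^'n^'m"
    show "dist (sigma_max M) (sigma_max N) \<le> C * dist M N"
      using le[of M N] le[of N M] by (simp add: dist_norm norm_minus_commute abs_le_iff)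
  qed (use C in simp)
  from continuous_on_compose2[OF lipschitz_on_continuous_on[OF this] assms] show ?thesis by simp
qed

section \<open>The square root of a positive definite matrix\<close>

lemma pos_def_coercive:
  fixes Q :: "real^'n^'n"
  assumes "pos_def Q"
  obtains a where "0 < a" "\<And>x. a * (norm x)\<^sup>2 \<le> x \<bullet> (Q *v x)"
proof -
  obtain e :: "real^'n" where e: "norm e = 1" by (rule vector_choose_size[of 1]) auto
  have "continuous_on (sphere 0 1) (\<lambda>x. x \<bullet> (Q *v x))"
    by (intro continuous_intros linear_continuous_on matrix_vector_mul_bounded_linear)
  then obtain v where v: "norm v = 1" "\<And>x. norm x = 1 \<Longrightarrow> v \<bullet> (Q *v v) \<le> x \<bullet> (Q *v x)"
    using continuous_attains_inf[of "sphere 0 1" "\<lambda>x. x \<bullet> (Q *v x)"] e by auto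
  have "v \<bullet> (Q *v v) * (norm x)\<^sup>2 \<le> x \<bullet> (Q *v x)" for x
  proof (cases "x = 0")
    case False
    let ?y = "inverse (norm x) *\<^sub>R x"
    have "v \<bullet> (Q *v v) \<le> ?y \<bullet> (Q *v ?y)" by (rule v(2)) (use False in simp)
    also have "\<dots> = x \<bullet> (Q *v x) / (norm x)\<^sup>2"
      by (simp add: matrix_vector_mult_scaleR power2_eq_square divide_inverse)
    finally show ?thesis using False by (simp add: pos_le_divide_eq)
  qed simp
  moreover have "v \<noteq> 0" using v(1) by auto
  then have "0 < v \<bullet> (Q *v v)" using assms by (simp add: pos_def_def)
  ultimately show ?thesis using that by blast
qed

lemma symmetric_matrix_inner:
  fixes Q :: "real^'n^'n"
  assumes "transpose Q = Q"
  shows "(Q *v x) \<bullet> y = x \<bullet> (Q *v y)"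
  by (metis assms dot_lmul_matrix inner_commute transpose_matrix_vector)

text \<open>After scaling, \<open>Q = I - X\<close> with an operator \<open>X\<close> of norm less than one, and the square root
  is \<open>I - Y\<close> for the fixed point of the contraction \<open>Y \<mapsto> (X + Y\<^sup>2) / 2\<close>.\<close>

lemma pos_def_sqrt_exists:
  fixes Q :: "real^'n^'n"
  assumes Q: "pos_def Q"
  obtains S where "pos_def S" "S ** S = Q"
proof -
  obtain a where a: "0 < a" "\<And>x. a * (norm x)\<^sup>2 \<le> x \<bullet> (Q *v x)"
    using pos_def_coercive[OF Q] by blast
  have symQ: "(Q *v x) \<bullet> y = x \<bullet> (Q *v y)" for x y
    using Q by (intro symmetric_matrix_inner) (simp add: pos_def_def)
  obtain b where b: "0 < b" "\<And>x. norm (Q *v x) \<le> norm x * b"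
    using bounded_linear.pos_bounded[OF matrix_vector_mul_bounded_linear[of Q]] by blast
  \<comment> \<open>The scaling that minimizes the bound \<open>1 - 2 * a / c + b\<^sup>2 / c\<^sup>2\<close> on the squared norm of
    \<open>X = I - Q / c\<close>.\<close>
  define c where "c = b\<^sup>2 / a"
  have c: "0 < c" using a b by (simp add: c_def)
  define X where "X = id_blinfun - (1 / c) *\<^sub>R Blinfun ((*v) Q)"
  have X: "blinfun_apply X x = x - (1 / c) *\<^sub>R (Q *v x)" for x
    by (simp add: X_def blinfun.bilinear_simps bounded_linear_Blinfun_apply)
  define q where "q = sqrt (max 0 (1 - a\<^sup>2 / b\<^sup>2))"
  have q: "0 \<le> q" "q < 1" using a b by (auto simp: q_def)
  have normX: "norm X \<le> q"
  proof (rule norm_blinfun_bound[OF q(1)])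
    fix x
    have "(norm (blinfun_apply X x))\<^sup>2 = (norm x)\<^sup>2 - 2 / c * (x \<bullet> (Q *v x)) + (norm (Q *v x))\<^sup>2 / c\<^sup>2"
      unfolding X power2_norm_eq_inner
      by (simp add: inner_simps inner_commute algebra_simps power2_eq_square)
    also have "\<dots> \<le> (norm x)\<^sup>2 - 2 / c * (a * (norm x)\<^sup>2) + (norm x * b)\<^sup>2 / c\<^sup>2"
      using a b c by (intro add_mono diff_mono mult_left_mono divide_right_mono power_mono) auto
    also have "\<dots> = (1 - a\<^sup>2 / b\<^sup>2) * (norm x)\<^sup>2"
      using a b by (simp add: c_def field_simps power2_eq_square)
    also have "\<dots> \<le> q\<^sup>2 * (norm x)\<^sup>2" by (intro mult_right_mono) (auto simp: q_def)
    finally have "(norm (blinfun_apply X x))\<^sup>2 \<le> (q * norm x)\<^sup>2" by (simp add: power_mult_distrib)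
    then show "norm (blinfun_apply X x) \<le> q * norm x" by (rule power2_le_imp_le) (use q in simp)
  qed
  define D :: "((real^'n) \<Rightarrow>\<^sub>L (real^'n)) set"
    where "D = {Y. norm Y \<le> q \<and> (\<forall>x y. blinfun_apply Y x \<bullet> y = x \<bullet> blinfun_apply Y y)}"
  define \<Phi> where "\<Phi> Y = (1 / 2) *\<^sub>R (X + (Y o\<^sub>L Y))" for Y
  have "closed D"
  proof -
    have "D = {Y. norm Y \<le> q} \<inter> (\<Inter>x. \<Inter>y. {Y. blinfun_apply Y x \<bullet> y = x \<bullet> blinfun_apply Y y})" by (auto simp: D_def)
    moreover have "closed {Y :: (real^'n) \<Rightarrow>\<^sub>L (real^'n). norm Y \<le> q}"
      by (intro closed_Collect_le continuous_intros)
    moreover have "closed {Y :: (real^'n) \<Rightarrow>\<^sub>L (real^'n). blinfun_apply Y x \<bullet> y = x \<bullet> blinfun_apply Y y}" for x y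
      by (intro closed_Collect_eq continuous_intros)
    ultimately show ?thesis by (metis (no_types, lifting) closed_INT closed_Int)
  qed
  then have "complete D" by (simp add: complete_eq_closed)
  moreover have "0 \<in> D" using q by (simp add: D_def)
  moreover have "\<Phi> ` D \<subseteq> D"
  proof safe
    fix Y assume Y: "Y \<in> D"
    have "norm (Y o\<^sub>L Y) \<le> q * q"
      using norm_blinfun_compose[of Y Y] Y q mult_mono[of "norm Y" q "norm Y" q]
      by (simp add: D_def)
    also have "\<dots> \<le> q * 1" using q by (intro mult_left_mono) auto
    finally have "norm (X + (Y o\<^sub>L Y)) \<le> 2 * q"
      using norm_triangle_ineq[of X "Y o\<^sub>L Y"] normX by simp
    moreover have "blinfun_apply (\<Phi> Y) x \<bullet> y = x \<bullet> \<Phi> Y y" for x y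
      using Y by (simp add: \<Phi>_def D_def blinfun.bilinear_simps X inner_simps symQ)
    ultimately show "\<Phi> Y \<in> D" by (simp add: D_def \<Phi>_def)
  qed
  moreover have "dist (\<Phi> Y) (\<Phi> Z) \<le> q * dist Y Z" if "Y \<in> D" "Z \<in> D" for Y Z
  proof -
    have "\<Phi> Y - \<Phi> Z = (1 / 2) *\<^sub>R ((Y o\<^sub>L (Y - Z)) + ((Y - Z) o\<^sub>L Z))"
      by (rule blinfun_eqI) (simp add: \<Phi>_def blinfun.bilinear_simps scaleR_diff_right[symmetric])
    then have "dist (\<Phi> Y) (\<Phi> Z) = norm ((Y o\<^sub>L (Y - Z)) + ((Y - Z) o\<^sub>L Z)) / 2"
      by (simp add: dist_norm)
    also have "\<dots> \<le> (norm Y * norm (Y - Z) + norm (Y - Z) * norm Z) / 2"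
      using norm_triangle_ineq[of "Y o\<^sub>L (Y - Z)" "(Y - Z) o\<^sub>L Z"]
        norm_blinfun_compose[of Y "Y - Z"] norm_blinfun_compose[of "Y - Z" Z] by simp
    also have "\<dots> \<le> (q * norm (Y - Z) + norm (Y - Z) * q) / 2"
      using that by (intro divide_right_mono add_mono mult_mono) (auto simp: D_def q)
    finally show ?thesis by (simp add: dist_norm)
  qed
  ultimately have "\<exists>!Y\<in>D. \<Phi> Y = Y" using q by (intro Banach_fix) auto
  then obtain Y where Y: "Y \<in> D" "\<Phi> Y = Y" by blast
  have YY: "blinfun_apply X x + blinfun_apply Y (blinfun_apply Y x) = 2 *\<^sub>R blinfun_apply Y x" for x
  proof -
    have "2 *\<^sub>R blinfun_apply Y x = 2 *\<^sub>R \<Phi> Y x" using Y(2) by simp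
    then show ?thesis by (simp add: \<Phi>_def blinfun.bilinear_simps)
  qed
  define S where "S = matrix (\<lambda>x. sqrt c *\<^sub>R (x - blinfun_apply Y x))"
  have S: "S *v x = sqrt c *\<^sub>R (x - blinfun_apply Y x)" for x
    unfolding S_def
    by (subst matrix_works) (auto intro!: Real_Vector_Spaces.linearI
        simp: blinfun.bilinear_simps algebra_simps linear_matrix_vector_mul_eq)
  have "S ** S = Q"
  proof (rule matrix_eq[THEN iffD2, rule_format])
    fix x
    have "(S ** S) *v x = c *\<^sub>R (x - 2 *\<^sub>R blinfun_apply Y x + blinfun_apply Y (blinfun_apply Y x))"
      using c by (simp add: matrix_vector_mul_assoc[symmetric] S blinfun.bilinear_simps
          scaleR_2 algebra_simps)
    also have "x - 2 *\<^sub>R blinfun_apply Y x + blinfun_apply Y (blinfun_apply Y x) = x - blinfun_apply X x" unfolding YY[symmetric] by simp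
    also have "c *\<^sub>R (x - blinfun_apply X x) = Q *v x" using c by (simp add: X)
    finally show "(S ** S) *v x = Q *v x" .
  qed
  moreover have "pos_def S"
    unfolding pos_def_def
  proof (intro conjI allI impI)
    have "(transpose S *v x) \<bullet> y = (S *v x) \<bullet> y" for x y
    proof -
      have "(transpose S *v x) \<bullet> y = x \<bullet> (S *v y)"
        by (metis dot_lmul_matrix transpose_matrix_vector)
      also have "\<dots> = (S *v x) \<bullet> y" using Y(1) by (simp add: S D_def inner_simps)
      finally show ?thesis .
    qed
    then show "transpose S = S" by (metis matrix_eq vector_eq_rdot)
    fix x :: "real^'n" assume x: "x \<noteq> 0"
    have "x \<bullet> blinfun_apply Y x \<le> norm x * (norm Y * norm x)"
      using norm_cauchy_schwarz[of x "blinfun_apply Y x"] norm_blinfun[of Y x]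
      by (meson mult_left_mono norm_ge_zero order_trans)
    also have "\<dots> \<le> norm x * (q * norm x)"
      using Y(1) by (intro mult_left_mono mult_right_mono) (auto simp: D_def)
    also have "\<dots> < norm x * (1 * norm x)"
      using q x by (intro mult_strict_left_mono mult_strict_right_mono) auto
    finally have "x \<bullet> blinfun_apply Y x < x \<bullet> x" by (simp add: dot_square_norm power2_eq_square)
    then show "0 < x \<bullet> (S *v x)" using c by (simp add: S inner_diff_right)
  qed
  ultimately show ?thesis using that by blast
qed

text \<open>For two square roots with difference \<open>D\<close>, cyclicity of the trace turns
  \<open>S D + D S' = 0\<close> into the vanishing of the trace of \<open>D (S + S') D\<close>, a sum to
  which every nonzero row of \<open>D\<close> contributes a positive term.\<close>

lemma pos_semidef_sqrt_unique:
  fixes S S' :: "real^'n^'n"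
  assumes S: "pos_def S" and S': "pos_semidef S'" and eq: "S ** S = S' ** S'"
  shows "S' = S"
proof -
  define D where "D = S - S'"
  have symD: "transpose D = D"
    using S S' by (simp add: D_def pos_def_def pos_semidef_def transpose_def vec_eq_iff)
  have sub: "A ** (B - C) = A ** B - A ** C" "(B - C) ** A = B ** A - C ** A"
    for A B C :: "real^'n^'n"
    by (simp_all add: vec_eq_iff matrix_matrix_mult_def sum_subtractf algebra_simps)
  have "S ** D + D ** S' = 0" by (simp add: D_def sub eq)
  then have "D ** (S ** D) + D ** (D ** S') = 0"
    by (simp add: matrix_add_ldistrib[symmetric])
  then have "trace (D ** (S ** D)) + trace (D ** (D ** S')) = 0"
    by (metis trace_0 trace_add mat_0)
  moreover have "trace (D ** (D ** S')) = trace (D ** (S' ** D))"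
    using trace_mul_sym[of D "D ** S'"] by (simp add: matrix_mul_assoc)
  moreover have tr: "trace (D ** (P ** D)) = (\<Sum>i\<in>UNIV. D $ i \<bullet> (P *v (D $ i)))" for P
  proof -
    have D: "D $ i $ j = D $ j $ i" for i j
      using symD by (metis transpose_def vec_lambda_beta)
    show ?thesis
      unfolding trace_def
      by (rule sum.cong[OF refl])
         (simp add: matrix_matrix_mult_def inner_vec_def matrix_vector_mult_def D[of _ "_"])
  qed
  ultimately have sum0: "(\<Sum>i\<in>UNIV. D $ i \<bullet> (S *v (D $ i)) + D $ i \<bullet> (S' *v (D $ i))) = 0"
    by (simp add: sum.distrib)
  have nonneg: "0 \<le> x \<bullet> (S *v x)" "0 \<le> x \<bullet> (S' *v x)" for x
    using S S' by (cases "x = 0"; simp add: pos_def_def pos_semidef_def less_imp_le)+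
  have "D $ i = 0" for i
  proof (rule ccontr)
    assume "D $ i \<noteq> 0"
    then have "0 < D $ i \<bullet> (S *v (D $ i))" using S by (simp add: pos_def_def)
    then show False
      using sum_nonneg_eq_0_iff[THEN iffD1, OF _ _ sum0] nonneg
      by (smt (verit, best) UNIV_I finite)
  qed
  then have "D = 0" by (simp add: vec_eq_iff)
  then show ?thesis by (simp add: D_def)
qed

lemma matrix_sqrt_square:
  assumes "pos_def Q"
  shows "matrix_sqrt Q ** matrix_sqrt Q = Q"
proof -
  obtain S where S: "pos_def S" "S ** S = Q" using pos_def_sqrt_exists[OF assms] .
  have "pos_semidef S"
    unfolding pos_semidef_def
  proof (intro conjI allI)
    show "transpose S = S" using S(1) by (simp add: pos_def_def)
    show "0 \<le> x \<bullet> (S *v x)" for x using S(1) by (cases "x = 0") (auto simp: pos_def_def less_imp_le)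
  qed
  then have "matrix_sqrt Q = S"
    unfolding matrix_sqrt_def
    using S by (intro the_equality conjI pos_semidef_sqrt_unique[OF S(1)]) auto
  then show ?thesis using S by simp
qed

lemma matrix_sqrt_left_inverse:
  assumes "pos_def Q"
  obtains P where "P ** matrix_sqrt Q = mat 1"
proof -
  have "x = 0" if "matrix_sqrt Q *v x = 0" for x
  proof (rule ccontr)
    assume "x \<noteq> 0"
    then have "0 < x \<bullet> (Q *v x)" using assms by (simp add: pos_def_def)
    moreover have "Q *v x = 0"
      using that matrix_sqrt_square[OF assms] by (metis matrix_vector_mul_assoc matrix_vector_mult_0_right)
    ultimately show False by simp
  qed
  then show ?thesis using that matrix_left_invertible_ker[of "matrix_sqrt Q"] by blast
qed

section \<open>Resolvents of Schur stable matrices\<close>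

lemma norm_smult: "norm (c *s (v :: complex^'n)) = cmod c * norm v"
  by (simp add: norm_vec_def L2_set_right_distrib norm_mult)

lemma mat_mult_vector: "mat c *v (x :: 'a::comm_semiring_1^'n) = c *s x"
  by (simp add: vec_eq_iff matrix_vector_mult_def mat_def if_distrib[of "\<lambda>t. t * _"] cong: if_cong)

lemma complexify_mult: "complexify (M ** N) = complexify M ** complexify N"
  by (simp add: complexify_def vec_eq_iff matrix_matrix_mult_def)

lemma complexify_mat_1: "complexify (mat 1) = mat 1"
  by (simp add: complexify_def vec_eq_iff mat_def)

lemma continuous_on_complexify:
  assumes "continuous_on S F"
  shows "continuous_on S (\<lambda>p. complexify (F p))"
proof -
  have "complexify (F p) = (\<chi> i j. complex_of_real (F p $ i $ j))" for p
    by (simp add: complexify_def vec_eq_iff)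
  then show ?thesis using assms by (simp add: continuous_intros)
qed

lemma matrix_inv_det:
  fixes M :: "'a::field^'n^'n"
  assumes "det M \<noteq> 0"
  shows "M ** matrix_inv M = mat 1" "matrix_inv M ** M = mat 1"
proof -
  have "\<exists>N. M ** N = mat 1 \<and> N ** M = mat 1"
    using assms by (simp add: invertible_det_nz[symmetric] invertible_def)
  then have "M ** matrix_inv M = mat 1 \<and> matrix_inv M ** M = mat 1"
    unfolding matrix_inv_def by (rule someI_ex)
  then show "M ** matrix_inv M = mat 1" "matrix_inv M ** M = mat 1" by auto
qed

lemma det_nonzero_if_injective:
  fixes M :: "'a::field^'n^'n"
  assumes "\<And>x. M *v x = 0 \<Longrightarrow> x = 0"
  shows "det M \<noteq> 0"
  using assms matrix_left_invertible_ker[of M]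
  by (simp add: invertible_det_nz[symmetric] invertible_left_inverse)

lemma matrix_inv_cramer:
  fixes M :: "'a::field^'n^'n"
  assumes "det M \<noteq> 0"
  shows "matrix_inv M
    = (\<chi> k j. det (\<chi> i p. if p = k then axis j 1 $ i else M $ i $ p) / det M)"
proof -
  have "matrix_inv M $ k $ j
      = det (\<chi> i p. if p = k then axis j 1 $ i else M $ i $ p) / det M" for k j
  proof -
    have "M *v (matrix_inv M *v axis j 1) = axis j 1"
      by (simp add: matrix_vector_mul_assoc matrix_inv_det(1)[OF assms])
    then have "matrix_inv M *v axis j 1
        = (\<chi> k. det (\<chi> i p. if p = k then axis j 1 $ i else M $ i $ p) / det M)"
      using cramer[OF assms] by blast
    moreover have "(matrix_inv M *v axis j 1) $ k = matrix_inv M $ k $ j"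
      by (simp add: matrix_vector_mult_def axis_def if_distrib[of "\<lambda>t. _ * t"] cong: if_cong)
    ultimately show ?thesis by simp
  qed
  then show ?thesis by (simp add: vec_eq_iff)
qed

lemma continuous_on_det:
  fixes F :: "'a::topological_space \<Rightarrow> complex^'n^'n"
  assumes "continuous_on S F"
  shows "continuous_on S (\<lambda>p. det (F p))"
  unfolding det_def by (intro continuous_intros assms)

lemma continuous_on_matrix_inv:
  fixes F :: "'a::topological_space \<Rightarrow> complex^'n^'n"
  assumes F: "continuous_on S F" and det: "\<And>p. p \<in> S \<Longrightarrow> det (F p) \<noteq> 0"
  shows "continuous_on S (\<lambda>p. matrix_inv (F p))"
proof -
  have "continuous_on S (\<lambda>p. if l = k then c else F p $ i $ l)" for i k l c
    by (cases "l = k") (auto intro!: continuous_intros F)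
  then have "continuous_on S
      (\<lambda>p. \<chi> k j. det (\<chi> i l. if l = k then axis j 1 $ i else F p $ i $ l) / det (F p))"
    by (intro continuous_on_vec_lambda continuous_on_divide continuous_on_det F det ballI)
  then show ?thesis
    by (rule continuous_on_eq) (simp add: matrix_inv_cramer det)
qed

lemma holomorphic_on_det:
  assumes "\<And>i j. (\<lambda>p. F p $ i $ j) holomorphic_on S"
  shows "(\<lambda>p. det (F p)) holomorphic_on S"
  unfolding det_def by (intro holomorphic_intros assms)

text \<open>Stability is used in the form that \<open>I - \<zeta> N\<close> is injective on the whole closed unit disc,
  the inverse \<open>1 / \<zeta>\<close> running through the spectral parameters of modulus at least one.\<close>

lemma schur_stable_iff:
  "schur_stable N \<longleftrightarrow>
    (\<forall>\<zeta> x. cmod \<zeta> \<le> 1 \<longrightarrow> x = \<zeta> *s (complexify N *v x) \<longrightarrow> x = 0)"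
proof (intro iffI allI impI)
  fix \<zeta> :: complex and x :: "complex^'a"
  assume N: "schur_stable N" and \<zeta>: "cmod \<zeta> \<le> 1" and x: "x = \<zeta> *s (complexify N *v x)"
  show "x = 0"
  proof (rule ccontr)
    assume "x \<noteq> 0"
    then have \<zeta>0: "\<zeta> \<noteq> 0" using x by (metis vector_smult_lzero)
    then have "complexify N *v x = (1 / \<zeta>) *s x"
      by (subst (2) x) (simp add: vector_smult_assoc)
    then have "cmod (1 / \<zeta>) < 1"
      using N \<open>x \<noteq> 0\<close> unfolding schur_stable_def eigenvalue_def by blast
    then show False using \<zeta> \<zeta>0 by (simp add: norm_divide divide_simps split: if_splits)
  qed
next
  assume inj: "\<forall>\<zeta> x. cmod \<zeta> \<le> 1 \<longrightarrow> x = \<zeta> *s (complexify N *v x) \<longrightarrow> x = 0"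
  show "schur_stable N"
    unfolding schur_stable_def eigenvalue_def
  proof (intro allI impI, elim exE conjE, rule ccontr)
    fix z v assume v: "v \<noteq> 0" "complexify N *v v = z *s v" and z: "\<not> cmod z < 1"
    then have "z \<noteq> 0" by auto
    then have "v = (1 / z) *s (complexify N *v v)" by (simp add: v(2) vector_smult_assoc)
    moreover have "cmod (1 / z) \<le> 1" using z by (simp add: norm_divide divide_le_eq)
    ultimately show False using inj v(1) by blast
  qed
qed

text \<open>The map \<open>\<zeta> \<mapsto> D (I - \<zeta> N)\<^sup>-\<^sup>1 y\<close> is holomorphic on the disc, with entries given by Cramer's
  rule. The maximum modulus principle extends a bound from the unit circle to the disc. It is applied
  to each entry, hence the dimension factor.\<close>

lemma resolvent_bound_on_disc:
  fixes N :: "complex^'n^'n" and D :: "complex^'n^'p"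
  assumes inj: "\<And>\<zeta> x. cmod \<zeta> \<le> 1 \<Longrightarrow> x = \<zeta> *s (N *v x) \<Longrightarrow> x = 0"
    and circle: "\<And>\<zeta> x. cmod \<zeta> = 1 \<Longrightarrow> norm (D *v x) \<le> b * norm (x - \<zeta> *s (N *v x))"
    and \<zeta>: "cmod \<zeta> \<le> 1"
  shows "norm (D *v x) \<le> real CARD('p) * b * norm (x - \<zeta> *s (N *v x))"
proof -
  define M where "M \<zeta> = mat 1 - mat \<zeta> ** N" for \<zeta>
  have M: "M \<zeta> *v x = x - \<zeta> *s (N *v x)" for \<zeta> x
    unfolding M_def matrix_vector_mult_diff_rdistrib
    by (simp add: matrix_vector_mul_assoc[symmetric] mat_mult_vector)
  have entry: "M \<zeta> $ i $ j = (if i = j then 1 else 0) - \<zeta> * N $ i $ j" for \<zeta> i j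
    by (simp add: M_def matrix_matrix_mult_def mat_def if_distrib[of "\<lambda>t. t * _"] cong: if_cong)
  have det: "det (M \<zeta>) \<noteq> 0" if "cmod \<zeta> \<le> 1" for \<zeta>
    by (rule det_nonzero_if_injective) (use inj[OF that] M in simp)
  define y where "y = M \<zeta> *v x"
  define X where "X \<xi> = (\<chi> k. det (\<chi> i j. if j = k then y $ i else M \<xi> $ i $ j) / det (M \<xi>))"
    for \<xi>
  have X: "M \<xi> *v X \<xi> = y" if "cmod \<xi> \<le> 1" for \<xi>
    using cramer[OF det[OF that], of "X \<xi>" y] by (simp add: X_def)
  have "M \<zeta> *v (X \<zeta> - x) = 0"
    using X[OF \<zeta>] by (simp add: matrix_vector_mult_diff_distrib y_def)
  then have "X \<zeta> - x = \<zeta> *s (N *v (X \<zeta> - x))" by (simp add: M)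
  then have Xx: "X \<zeta> = x" using inj[OF \<zeta>] by (metis eq_iff_diff_eq_0)
  have comp: "cmod ((D *v x) $ p) \<le> b * norm y" for p
  proof -
    define g where "g \<xi> = (D *v X \<xi>) $ p" for \<xi>
    have hol_entry: "(\<lambda>\<xi>. M \<xi> $ i $ j) holomorphic_on S" for i j S
      unfolding entry by (intro holomorphic_intros)
    have "(\<lambda>\<xi>. (\<chi> i j. if j = k then y $ i else M \<xi> $ i $ j) $ i $ j) holomorphic_on S" for i j k S
      by (cases "j = k") (simp_all add: hol_entry)
    then have "(\<lambda>\<xi>. X \<xi> $ k) holomorphic_on cball 0 1" for k
      unfolding X_def vec_lambda_beta
      by (intro holomorphic_on_divide holomorphic_on_det hol_entry) (use det in auto)
    then have hol: "g holomorphic_on cball 0 1"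
      unfolding g_def matrix_vector_mult_def vec_lambda_beta by (intro holomorphic_intros)
    have "norm (g \<zeta>) \<le> b * norm y"
    proof (rule maximum_modulus_frontier[where f = g and S = "cball 0 1" and \<xi> = \<zeta>])
      show "g holomorphic_on interior (cball 0 1)"
        by (rule holomorphic_on_subset[OF hol interior_subset])
      show "continuous_on (closure (cball 0 1)) g"
        using hol by (simp add: holomorphic_on_imp_continuous_on)
      show "norm (g \<xi>) \<le> b * norm y" if "\<xi> \<in> frontier (cball 0 1)" for \<xi>
      proof -
        have \<xi>: "cmod \<xi> = 1" using that by (simp add: frontier_cball)
        have "norm (g \<xi>) \<le> norm (D *v X \<xi>)" unfolding g_def by (rule Finite_Cartesian_Product.norm_nth_le)
        also have "\<dots> \<le> b * norm (M \<xi> *v X \<xi>)" unfolding M by (rule circle[OF \<xi>])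
        finally show ?thesis using X[of \<xi>] \<xi> by simp
      qed
    qed (use \<zeta> in auto)
    then show ?thesis by (simp add: g_def Xx)
  qed
  have "norm (D *v x) \<le> (\<Sum>p\<in>UNIV. cmod ((D *v x) $ p))"
    unfolding norm_vec_def by (rule L2_set_le_sum) simp
  also have "\<dots> \<le> (\<Sum>p\<in>(UNIV::'p set). b * norm y)" by (rule sum_mono) (rule comp)
  finally show ?thesis by (simp add: y_def M mult.assoc)
qed

lemma norm_vec_sum:
  fixes v :: "complex^('p::finite + 'q::finite)"
  shows "(norm v)\<^sup>2 = (norm (\<chi> i. v $ Inl i))\<^sup>2 + (norm (\<chi> j. v $ Inr j))\<^sup>2"
proof -
  have "(\<Sum>i\<in>UNIV. (norm (v $ i))\<^sup>2)
      = (\<Sum>i\<in>UNIV. (norm (v $ Inl i))\<^sup>2) + (\<Sum>j\<in>UNIV. (norm (v $ Inr j))\<^sup>2)"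
    by (simp add: UNIV_Plus_UNIV[symmetric] sum.Plus comp_def del: UNIV_Plus_UNIV)
  then show ?thesis by (simp add: norm_vec_def L2_set_def sum_nonneg)
qed

lemma norm_complexify_vstack:
  "norm (complexify M *v x) \<le> norm (complexify (vstack M N) *v x)"
  "norm (complexify N *v x) \<le> norm (complexify (vstack M N) *v x)"
proof -
  let ?v = "complexify (vstack M N) *v x"
  have "(\<chi> i. ?v $ Inl i) = complexify M *v x" "(\<chi> j. ?v $ Inr j) = complexify N *v x"
    by (simp_all add: vec_eq_iff matrix_vector_mult_def complexify_def vstack_def)
  then have "(norm ?v)\<^sup>2 = (norm (complexify M *v x))\<^sup>2 + (norm (complexify N *v x))\<^sup>2"
    using norm_vec_sum[of ?v] by simp
  then have sq: "(norm (complexify M *v x))\<^sup>2 \<le> (norm ?v)\<^sup>2"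
    "(norm (complexify N *v x))\<^sup>2 \<le> (norm ?v)\<^sup>2"
    by simp_all
  show "norm (complexify M *v x) \<le> norm ?v" by (rule power2_le_imp_le[OF sq(1)]) simp
  show "norm (complexify N *v x) \<le> norm ?v" by (rule power2_le_imp_le[OF sq(2)]) simp
qed

lemma continuous_on_vstack:
  fixes F :: "'a::topological_space \<Rightarrow> real^'n^'p::finite" and G :: "'a \<Rightarrow> real^'n^'q::finite"
  assumes "continuous_on S F" "continuous_on S G"
  shows "continuous_on S (\<lambda>s. vstack (F s) (G s))"
  unfolding vstack_def
proof (rule continuous_on_vec_lambda)
  fix i :: "'p + 'q"
  show "continuous_on S (\<lambda>s. case i of Inl p \<Rightarrow> F s $ p | Inr q \<Rightarrow> G s $ q)"
    by (cases i) (auto intro: continuous_intros assms)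
qed

section \<open>The H-infinity cost\<close>

locale hinf_problem =
  fixes A :: "real^'nx^'nx" and B :: "real^'nu^'nx" and Bw :: "real^'nw^'nx"
    and C :: "real^'nx^'ny" and Q :: "real^'nx^'nx" and R :: "real^'nu^'nu"
  assumes rank_Bw: "rank Bw = CARD('nx)" and rank_C: "rank C = CARD('ny)"
    and Q: "pos_def Q" and R: "pos_def R"
begin

abbreviation "stab \<equiv> stabilizing_gains A B C"

abbreviation "cost \<equiv> hinf_cost A B Bw C Q R"

abbreviation "closed_loop K \<equiv> complexify (A + B ** K ** C)"

abbreviation "gain K \<omega> \<equiv> sigma_max (transfer_matrix A B Bw C Q R K \<omega>)"

lemma stab_injective:
  "K \<in> stab \<Longrightarrow> cmod \<zeta> \<le> 1 \<Longrightarrow> x = \<zeta> *s (closed_loop K *v x) \<Longrightarrow> x = 0"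
  unfolding stabilizing_gains_def schur_stable_iff by blast

lemma continuous_on_closed_loop: "continuous_on S closed_loop"
  by (intro continuous_on_complexify continuous_intros
      bounded_bilinear.continuous_on[OF bounded_bilinear_matrix_matrix])

lemma pencil_mult: "(mat z - closed_loop K) *v x = z *s x - closed_loop K *v x"
  by (simp add: matrix_vector_mult_diff_rdistrib mat_mult_vector)

lemma det_pencil:
  assumes K: "K \<in> stab" and z: "cmod z = 1"
  shows "det (mat z - closed_loop K) \<noteq> 0"
proof (rule det_nonzero_if_injective)
  fix x assume "(mat z - closed_loop K) *v x = 0"
  then have "z *s x = closed_loop K *v x" by (simp add: pencil_mult)
  then have "(1 / z) *s (closed_loop K *v x) = (1 / z) *s (z *s x)" by simp
  moreover have "z \<noteq> 0" using z by auto
  ultimately have "x = (1 / z) *s (closed_loop K *v x)" by (simp add: vector_smult_assoc)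
  moreover have "cmod (1 / z) \<le> 1" using z by (simp add: norm_divide)
  ultimately show "x = 0" using stab_injective[OF K] by blast
qed

lemma continuous_on_gain: "continuous_on (stab \<times> UNIV) (\<lambda>(K, \<omega>). gain K \<omega>)"
proof -
  have cl: "continuous_on S (\<lambda>p. closed_loop (fst p))" for S :: "((real^'ny^'nu) \<times> real) set"
    by (rule continuous_on_compose2[OF continuous_on_closed_loop[of UNIV]])
       (auto intro: continuous_intros)
  have "continuous_on S (\<lambda>p. mat (cis (snd p)) :: complex^'nx^'nx)"
    for S :: "((real^'ny^'nu) \<times> real) set"
  proof -
    have "continuous_on S (\<lambda>p. if i = j then cis (snd p) else 0)" for i j :: 'nx
      by (cases "i = j") (auto intro!: continuous_intros simp: cis_conv_exp)
    then show ?thesis unfolding mat_def by (intro continuous_on_vec_lambda)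
  qed
  then have inv: "continuous_on (stab \<times> UNIV)
      (\<lambda>p. matrix_inv (mat (cis (snd p)) - closed_loop (fst p)))"
    by (intro continuous_on_matrix_inv continuous_on_diff cl) (auto simp: det_pencil)
  have "continuous_on (stab \<times> UNIV)
      (\<lambda>p. transfer_matrix A B Bw C Q R (fst p) (snd p))"
    unfolding transfer_matrix_def
    by (intro bounded_bilinear.continuous_on[OF bounded_bilinear_matrix_matrix] inv
        continuous_on_complexify continuous_on_vstack continuous_intros)
  then show ?thesis unfolding case_prod_beta by (rule continuous_on_sigma_max)
qed

lemma bdd_above_gain: "K \<in> stab \<Longrightarrow> bdd_above (gain K ` {0..2 * pi})"
proof -
  assume K: "K \<in> stab"
  have "continuous_on {0..2 * pi} (\<lambda>\<omega>. (\<lambda>(K, \<omega>). gain K \<omega>) (K, \<omega>))"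
    by (rule continuous_on_compose2[OF continuous_on_gain]) (use K in \<open>auto intro: continuous_intros\<close>)
  then have "compact (gain K ` {0..2 * pi})"
    by (intro compact_continuous_image) auto
  then show ?thesis by (intro bounded_imp_bdd_above compact_imp_bounded)
qed

lemma gain_le_cost: "K \<in> stab \<Longrightarrow> \<omega> \<in> {0..2 * pi} \<Longrightarrow> gain K \<omega> \<le> cost K"
  unfolding hinf_cost_def by (rule cSUP_upper[OF _ bdd_above_gain])

lemma cost_le: "(\<And>\<omega>. \<omega> \<in> {0..2 * pi} \<Longrightarrow> gain K \<omega> \<le> b) \<Longrightarrow> cost K \<le> b"
  unfolding hinf_cost_def by (rule cSUP_least) auto

lemma cost_nonneg: "K \<in> stab \<Longrightarrow> 0 \<le> cost K"
  using gain_le_cost[of K 0] sigma_max_nonneg[of "transfer_matrix A B Bw C Q R K 0"] by simp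

text \<open>By compactness of the disc and of the unit sphere, injectivity of \<open>I - \<zeta> N\<close> on the disc is
  quantitative, with a constant \<open>\<delta>\<close> that survives small perturbations of the gain.\<close>

lemma open_stab: "open stab"
proof (rule open_subopen[THEN iffD2], rule ballI)
  fix P assume P: "P \<in> stab"
  let ?f = "\<lambda>(\<zeta>, x). norm (x - \<zeta> *s (closed_loop P *v x))"
  obtain e :: "complex^'nx" where e: "norm e = 1" by (rule vector_choose_size[of 1]) auto
  have "continuous_on S (\<lambda>p. fst p *s (closed_loop P *v snd p))"
    for S :: "(complex \<times> (complex^'nx)) set"
    unfolding vec_eq_iff vector_scalar_mult_def
    by (intro continuous_intros continuous_on_vec_lambda
        bounded_bilinear.continuous_on[OF bounded_bilinear_matrix_vector])
  then have "continuous_on (cball 0 1 \<times> sphere 0 1) ?f"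
    unfolding case_prod_beta by (intro continuous_intros)
  then obtain p where p: "p \<in> cball 0 1 \<times> sphere 0 1" "\<And>q. q \<in> cball 0 1 \<times> sphere 0 1 \<Longrightarrow> ?f p \<le> ?f q"
    using continuous_attains_inf[of "cball (0::complex) 1 \<times> sphere (0::complex^'nx) 1" ?f] e
    by (auto simp: compact_Times)
  define \<delta> where "\<delta> = ?f p"
  have "snd p - fst p *s (closed_loop P *v snd p) \<noteq> 0"
    using stab_injective[OF P, of "fst p" "snd p"] p(1) by auto
  then have \<delta>: "0 < \<delta>" by (simp add: \<delta>_def case_prod_beta)
  have low: "\<delta> * norm x \<le> norm (x - \<zeta> *s (closed_loop P *v x))" if \<zeta>: "cmod \<zeta> \<le> 1" for \<zeta> x
  proof (cases "x = 0")
    case False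
    let ?r = "complex_of_real (1 / norm x)"
    have "norm (?r *s x) = 1" using False by (simp only: norm_smult) (simp add: norm_divide)
    then have "\<delta> \<le> ?f (\<zeta>, ?r *s x)" unfolding \<delta>_def using \<zeta> by (intro p(2)) simp
    also have "?r *s x - \<zeta> *s (closed_loop P *v (?r *s x)) = ?r *s (x - \<zeta> *s (closed_loop P *v x))"
      by (simp add: vector_scalar_commute vector_smult_assoc vec_eq_iff algebra_simps)
    then have "?f (\<zeta>, ?r *s x) = norm (x - \<zeta> *s (closed_loop P *v x)) / norm x"
      by (simp only: case_prod_conv norm_smult) (simp add: norm_divide)
    finally show ?thesis using False by (simp add: pos_le_divide_eq)
  qed simp
  obtain c where c: "0 < c" "\<And>(M::complex^'nx^'nx) x. norm (M *v x) \<le> norm M * norm x * c"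
    using bounded_bilinear.pos_bounded[OF bounded_bilinear_matrix_vector] by blast
  let ?W = "{K. norm (closed_loop K - closed_loop P) * c < \<delta>}"
  have "open ?W" by (intro open_Collect_less continuous_intros continuous_on_closed_loop)
  moreover have "P \<in> ?W" using \<delta> by simp
  moreover have "?W \<subseteq> stab"
  proof
    fix K assume K: "K \<in> ?W"
    have "x = 0" if \<zeta>: "cmod \<zeta> \<le> 1" and x: "x = \<zeta> *s (closed_loop K *v x)" for \<zeta> x
    proof (rule ccontr)
      assume "x \<noteq> 0"
      have "x - \<zeta> *s (closed_loop P *v x) = \<zeta> *s (closed_loop K *v x) - \<zeta> *s (closed_loop P *v x)"
        by (subst (1) x) simp
      also have "\<dots> = \<zeta> *s ((closed_loop K - closed_loop P) *v x)"
        by (simp add: matrix_vector_mult_diff_rdistrib vec_eq_iff algebra_simps)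
      finally have "\<delta> * norm x \<le> norm (\<zeta> *s ((closed_loop K - closed_loop P) *v x))"
        using low[OF \<zeta>, of x] by simp
      also have "\<dots> \<le> 1 * norm ((closed_loop K - closed_loop P) *v x)"
        unfolding norm_smult using \<zeta> by (intro mult_right_mono) auto
      also have "\<dots> \<le> norm (closed_loop K - closed_loop P) * c * norm x"
        using c(2)[of "closed_loop K - closed_loop P" x] by (simp add: mult_ac)
      also have "\<dots> < \<delta> * norm x" using K \<open>x \<noteq> 0\<close> by (intro mult_strict_right_mono) auto
      finally show False by simp
    qed
    then show "K \<in> stab" unfolding stabilizing_gains_def schur_stable_iff by blast
  qed
  ultimately show "\<exists>W. open W \<and> P \<in> W \<and> W \<subseteq> stab" by blast
qed

text \<open>Near a stabilizing gain, joint continuity in gain and frequency is uniform in the frequency,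
  since the frequencies form a compact set. The supremum inherits it.\<close>

lemma continuous_on_cost: "continuous_on stab cost"
proof (rule continuous_on_iff[THEN iffD2, rule_format])
  fix P and e :: real assume P: "P \<in> stab" and e: "0 < e"
  obtain r where r: "0 < r" "cball P r \<subseteq> stab"
    using open_stab P open_contains_cball by blast
  have "continuous_on (cball P r \<times> {0..2 * pi}) (\<lambda>(K, \<omega>). gain K \<omega>)"
    by (rule continuous_on_subset[OF continuous_on_gain]) (use r in auto)
  then have "uniformly_continuous_on (cball P r \<times> {0..2 * pi}) (\<lambda>(K, \<omega>). gain K \<omega>)"
    by (rule compact_uniformly_continuous) (simp add: compact_Times)
  then obtain \<delta> where \<delta>: "0 < \<delta>"
    "\<And>p q. p \<in> cball P r \<times> {0..2 * pi} \<Longrightarrow> q \<in> cball P r \<times> {0..2 * pi} \<Longrightarrow> dist q p < \<delta> \<Longrightarrow>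
      dist ((\<lambda>(K, \<omega>). gain K \<omega>) q) ((\<lambda>(K, \<omega>). gain K \<omega>) p) < e / 2"
    unfolding uniformly_continuous_on_def using e by (metis half_gt_zero)
  have "dist (cost K) (cost P) < e" if K: "K \<in> stab" and dist: "dist K P < min \<delta> r" for K
  proof -
    have near: "\<bar>gain K \<omega> - gain P \<omega>\<bar> < e / 2" if "\<omega> \<in> {0..2 * pi}" for \<omega>
      using \<delta>(2)[of "(P, \<omega>)" "(K, \<omega>)"] dist that r(1)
      by (auto simp: dist_Pair_Pair dist_real_def dist_commute)
    have "cost K \<le> cost P + e / 2"
      by (rule cost_le) (use near gain_le_cost[OF P] in \<open>smt (verit)\<close>)
    moreover have "cost P \<le> cost K + e / 2"
      by (rule cost_le) (use near gain_le_cost[OF K] in \<open>smt (verit)\<close>)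
    ultimately show ?thesis using e by (simp add: dist_real_def abs_le_iff)
  qed
  then show "\<exists>\<delta>>0. \<forall>K\<in>stab. dist K P < \<delta> \<longrightarrow> dist (cost K) (cost P) < e"
    using \<delta>(1) r(1) by (intro exI[of _ "min \<delta> r"]) auto
qed

text \<open>Full row rank of \<open>Bw\<close> makes every state direction reachable by the disturbance. Since the
  weights are invertible, the cost then bounds both the resolvent and \<open>K C\<close> times the resolvent on
  the unit circle.\<close>

lemma cost_bounds_resolvent:
  "\<exists>c>0. \<forall>K\<in>stab. \<forall>\<zeta> x. cmod \<zeta> = 1 \<longrightarrow>
      norm x \<le> c * cost K * norm (x - \<zeta> *s (closed_loop K *v x))
      \<and> norm (complexify (K ** C) *v x) \<le> c * cost K * norm (x - \<zeta> *s (closed_loop K *v x))"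
proof -
  obtain Bi where "Bw ** Bi = mat 1"
    using rank_Bw matrix_right_invertible_surjective[of Bw] by (auto simp: full_rank_surjective)
  then have Bi: "complexify Bw ** complexify Bi = mat 1"
    by (metis complexify_mult complexify_mat_1)
  obtain PQ where "PQ ** matrix_sqrt Q = mat 1" using matrix_sqrt_left_inverse[OF Q] .
  then have PQ: "complexify PQ ** complexify (matrix_sqrt Q) = mat 1"
    by (metis complexify_mult complexify_mat_1)
  obtain PR where "PR ** matrix_sqrt R = mat 1" using matrix_sqrt_left_inverse[OF R] .
  then have PR: "complexify PR ** complexify (matrix_sqrt R) = mat 1"
    by (metis complexify_mult complexify_mat_1)
  obtain b where b: "0 < b" "\<And>x. norm (complexify Bi *v x) \<le> norm x * b"
    using bounded_linear.pos_bounded[OF matrix_vector_mul_bounded_linear] by blast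
  obtain q where q: "0 < q" "\<And>x. norm (complexify PQ *v x) \<le> norm x * q"
    using bounded_linear.pos_bounded[OF matrix_vector_mul_bounded_linear] by blast
  obtain r where r: "0 < r" "\<And>x. norm (complexify PR *v x) \<le> norm x * r"
    using bounded_linear.pos_bounded[OF matrix_vector_mul_bounded_linear] by blast
  define c where "c = max q r * b"
  have "norm x \<le> c * cost K * norm (x - \<zeta> *s (closed_loop K *v x))
      \<and> norm (complexify (K ** C) *v x) \<le> c * cost K * norm (x - \<zeta> *s (closed_loop K *v x))"
    if K: "K \<in> stab" and \<zeta>: "cmod \<zeta> = 1" for K \<zeta> x
  proof -
    define z where "z = 1 / \<zeta>"
    have z: "cmod z = 1" "\<zeta> * z = 1" using \<zeta> by (auto simp: z_def norm_divide)
    define \<omega> where "\<omega> = Arg2pi z"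
    have \<omega>: "\<omega> \<in> {0..2 * pi}" "z = cis \<omega>"
      using Arg2pi[of z] z(1) by (auto simp: \<omega>_def cis_conv_exp is_Arg_def)
    define y where "y = (mat z - closed_loop K) *v x"
    have "\<zeta> *s y = x - \<zeta> *s (closed_loop K *v x)"
      unfolding y_def pencil_mult vector_ssub_ldistrib vector_smult_assoc z(2) by simp
    then have ny: "norm y = norm (x - \<zeta> *s (closed_loop K *v x))"
      by (metis \<zeta> mult_1 norm_smult)
    let ?V = "vstack (matrix_sqrt Q) (matrix_sqrt R ** K ** C)" and ?w = "complexify Bi *v y"
    have "complexify Bw *v ?w = y" using Bi by (simp add: matrix_vector_mul_assoc)
    then have "transfer_matrix A B Bw C Q R K \<omega> *v ?w
        = complexify ?V *v (matrix_inv (mat z - closed_loop K) *v y)"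
      unfolding transfer_matrix_def \<omega>(2)[symmetric] by (simp add: matrix_vector_mul_assoc[symmetric])
    also have "matrix_inv (mat z - closed_loop K) *v y = x"
      unfolding y_def matrix_vector_mul_assoc
      using matrix_inv_det(2)[OF det_pencil[OF K z(1)]] by simp
    finally have "norm (complexify ?V *v x) \<le> gain K \<omega> * norm ?w"
      by (metis norm_mult_le_sigma_max)
    also have "\<dots> \<le> cost K * (norm y * b)"
      using gain_le_cost[OF K \<omega>(1)] b cost_nonneg[OF K] by (intro mult_mono) auto
    finally have V: "norm (complexify ?V *v x) \<le> cost K * (norm y * b)" .
    have V0: "0 \<le> cost K * (norm y * b)" using cost_nonneg[OF K] b by simp
    have "x = complexify PQ *v (complexify (matrix_sqrt Q) *v x)"
      using PQ by (simp add: matrix_vector_mul_assoc)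
    then have "norm x \<le> norm (complexify (matrix_sqrt Q) *v x) * q" using q(2) by metis
    also have "\<dots> \<le> cost K * (norm y * b) * max q r"
      using norm_complexify_vstack(1)[of "matrix_sqrt Q" x "matrix_sqrt R ** K ** C"] V V0 q
      by (intro mult_mono) auto
    finally have 1: "norm x \<le> c * cost K * norm y" by (simp add: c_def mult_ac)
    have "complexify (K ** C) *v x = complexify PR *v (complexify (matrix_sqrt R ** K ** C) *v x)"
      using PR by (simp add: matrix_vector_mul_assoc complexify_mult matrix_mul_assoc)
    then have "norm (complexify (K ** C) *v x) \<le> norm (complexify (matrix_sqrt R ** K ** C) *v x) * r"
      using r(2) by metis
    also have "\<dots> \<le> cost K * (norm y * b) * max q r"
      using norm_complexify_vstack(2)[of "matrix_sqrt R ** K ** C" x "matrix_sqrt Q"] V V0 r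
      by (intro mult_mono) auto
    finally have 2: "norm (complexify (K ** C) *v x) \<le> c * cost K * norm y"
      by (simp add: c_def mult_ac)
    show ?thesis using 1 2 unfolding ny by blast
  qed
  moreover have "0 < c" using q b by (simp add: c_def less_max_iff_disj)
  ultimately show ?thesis by (intro exI[of _ c]) blast
qed

text \<open>On the whole disc the bounds are closed conditions on \<open>K\<close> that enforce stability. At \<open>\<zeta> = 0\<close> they
  bound \<open>K C\<close> itself, hence \<open>K\<close>, as \<open>C\<close> has full row rank. So the cost blows up at the boundary of the stabilizing set and at infinity.\<close>

lemma closed_sublevel: "closed {K \<in> stab. cost K \<le> b}"
proof -
  obtain c where c: "0 < c" and res:
    "\<forall>K\<in>stab. \<forall>\<zeta> x. cmod \<zeta> = 1 \<longrightarrow>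
      norm x \<le> c * cost K * norm (x - \<zeta> *s (closed_loop K *v x))
      \<and> norm (complexify (K ** C) *v x) \<le> c * cost K * norm (x - \<zeta> *s (closed_loop K *v x))"
    using cost_bounds_resolvent by (elim exE conjE)
  define E where "E = {K. \<forall>\<zeta> x. cmod \<zeta> \<le> 1 \<longrightarrow>
    norm x \<le> real CARD('nx) * (c * b) * norm (x - \<zeta> *s (closed_loop K *v x))}"
  have "closed {K. norm x \<le> real CARD('nx) * (c * b) * norm (x - \<zeta> *s (closed_loop K *v x))}"
    for \<zeta> x
    unfolding mat_mult_vector[symmetric]
    by (intro closed_Collect_le continuous_intros continuous_on_closed_loop
        bounded_bilinear.continuous_on[OF bounded_bilinear_matrix_vector])
  moreover have "E = (\<Inter>\<zeta>\<in>{\<zeta>. cmod \<zeta> \<le> 1}. \<Inter>x.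
      {K. norm x \<le> real CARD('nx) * (c * b) * norm (x - \<zeta> *s (closed_loop K *v x))})"
    by (auto simp: E_def)
  ultimately have "closed E" by (simp only:) (intro closed_INT ballI)
  have "E \<subseteq> stab"
  proof
    fix K assume K: "K \<in> E"
    have "x = 0" if "cmod \<zeta> \<le> 1" "x = \<zeta> *s (closed_loop K *v x)" for \<zeta> x
    proof -
      have "norm x \<le> real CARD('nx) * (c * b) * norm (x - \<zeta> *s (closed_loop K *v x))"
        using K that(1) unfolding E_def by blast
      then show ?thesis using that(2) by simp
    qed
    then show "K \<in> stab" unfolding stabilizing_gains_def schur_stable_iff by blast
  qed
  have "K \<in> E" if K: "K \<in> stab" "cost K \<le> b" for K
  proof -
    have "norm (mat 1 *v x) \<le> real CARD('nx) * (c * b) * norm (x - \<zeta> *s (closed_loop K *v x))"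
      if \<zeta>: "cmod \<zeta> \<le> 1" for \<zeta> x
    proof (rule resolvent_bound_on_disc[OF stab_injective[OF K(1)] _ \<zeta>])
      fix \<zeta> :: complex and x :: "complex^'nx" assume \<zeta>: "cmod \<zeta> = 1"
      have "norm x \<le> c * cost K * norm (x - \<zeta> *s (closed_loop K *v x))" using res K(1) \<zeta> by blast
      also have "\<dots> \<le> c * b * norm (x - \<zeta> *s (closed_loop K *v x))"
        using c K(2) by (intro mult_right_mono mult_left_mono) auto
      finally show "norm (mat 1 *v x) \<le> c * b * norm (x - \<zeta> *s (closed_loop K *v x))" by simp
    qed
    then show ?thesis by (simp add: E_def)
  qed
  then have "{K \<in> stab. cost K \<le> b} = {K \<in> E. cost K \<le> b}" using \<open>E \<subseteq> stab\<close> by auto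
  then show ?thesis
    using continuous_on_closed_Collect_le[OF continuous_on_subset[OF continuous_on_cost \<open>E \<subseteq> stab\<close>]
        continuous_on_const \<open>closed E\<close>] by simp
qed

lemma bounded_sublevel: "bounded {K \<in> stab. cost K \<le> b}"
proof -
  obtain c where c: "0 < c" and res:
    "\<forall>K\<in>stab. \<forall>\<zeta> x. cmod \<zeta> = 1 \<longrightarrow>
      norm x \<le> c * cost K * norm (x - \<zeta> *s (closed_loop K *v x))
      \<and> norm (complexify (K ** C) *v x) \<le> c * cost K * norm (x - \<zeta> *s (closed_loop K *v x))"
    using cost_bounds_resolvent by (elim exE conjE)
  obtain Ci where Ci: "C ** Ci = mat 1"
    using rank_C matrix_right_invertible_surjective[of C] by (auto simp: full_rank_surjective)
  obtain k where k: "0 < k" "\<And>(M :: real^'nx^'nu) (N :: real^'ny^'nx). norm (M ** N) \<le> norm M * norm N * k"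
    using bounded_bilinear.pos_bounded[OF bounded_bilinear_matrix_matrix] by blast
  define h where "h = real CARD('nu) * (c * b)"
  have "norm K \<le> real CARD('nu) * (real CARD('nx) * h) * norm Ci * k"
    if K: "K \<in> stab" "cost K \<le> b" for K
  proof -
    have disc: "norm (complexify (K ** C) *v x) \<le> h * norm (x - 0 *s (closed_loop K *v x))" for x
      unfolding h_def
    proof (rule resolvent_bound_on_disc[OF stab_injective[OF K(1)]])
      fix \<zeta> :: complex and x :: "complex^'nx" assume \<zeta>: "cmod \<zeta> = 1"
      have "norm (complexify (K ** C) *v x) \<le> c * cost K * norm (x - \<zeta> *s (closed_loop K *v x))"
        using res K(1) \<zeta> by blast
      also have "\<dots> \<le> c * b * norm (x - \<zeta> *s (closed_loop K *v x))"
        using c K(2) by (intro mult_right_mono mult_left_mono) auto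
      finally show "norm (complexify (K ** C) *v x) \<le> c * b * norm (x - \<zeta> *s (closed_loop K *v x))" .
    qed simp_all
    have entry: "norm ((K ** C) $ i $ j) \<le> h" for i j
    proof -
      have "(complexify (K ** C) *v axis j 1) $ i = complex_of_real ((K ** C) $ i $ j)"
        by (simp add: matrix_vector_mult_def axis_def complexify_def if_distrib[of "\<lambda>t. _ * t"]
            cong: if_cong)
      then have "norm ((K ** C) $ i $ j) = cmod ((complexify (K ** C) *v axis j 1) $ i)" by simp
      also have "\<dots> \<le> norm (complexify (K ** C) *v axis j 1)"
        by (rule Finite_Cartesian_Product.norm_nth_le)
      also have "\<dots> \<le> h * norm (axis j (1::complex))" using disc[of "axis j 1"] by simp
      finally show ?thesis by simp
    qed
    have "norm (K ** C) \<le> (\<Sum>i\<in>UNIV. norm ((K ** C) $ i))"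
      by (subst norm_vec_def) (simp add: L2_set_le_sum)
    also have "\<dots> \<le> (\<Sum>i\<in>(UNIV::'nu set). \<Sum>j\<in>UNIV. norm ((K ** C) $ i $ j))"
      by (rule sum_mono) (simp add: norm_vec_def[of "_ $ _"] L2_set_le_sum)
    also have "\<dots> \<le> (\<Sum>i\<in>(UNIV::'nu set). \<Sum>j\<in>(UNIV::'nx set). h)"
      by (intro sum_mono entry)
    finally have KC: "norm (K ** C) \<le> real CARD('nu) * (real CARD('nx) * h)" by simp
    have "K = (K ** C) ** Ci" using Ci by (simp add: matrix_mul_assoc[symmetric])
    then have "norm K \<le> norm (K ** C) * norm Ci * k" using k(2) by metis
    also have "\<dots> \<le> real CARD('nu) * (real CARD('nx) * h) * norm Ci * k"
      using KC k(1) by (intro mult_right_mono) auto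
    finally show ?thesis .
  qed
  then show ?thesis by (intro boundedI) blast
qed

lemma open_strict_sublevel: "open {K \<in> stab. cost K < b}"
proof -
  have "open (stab \<inter> cost -` {..<b})"
    by (intro continuous_open_preimage continuous_on_cost open_stab open_lessThan)
  moreover have "stab \<inter> cost -` {..<b} = {K \<in> stab. cost K < b}" by auto
  ultimately show ?thesis by simp
qed

end

section \<open>The margin between the sublevel sets\<close>

text \<open>A frontier point of the larger sublevel set belongs to that set, since it is closed. By the
  Lipschitz bound its cost would be less than \<open>2 * b\<close> if it were closer than \<open>b / l\<close> to the smaller
  set. But the points of cost less than \<open>2 * b\<close> are interior.\<close>

lemma (in hinf_problem) sublevel_margin:
  fixes b l :: real
  defines "S\<^sub>0 \<equiv> {K \<in> stab. cost K \<le> b}" and "S \<equiv> {K \<in> stab. cost K \<le> 2 * b}"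
  defines "d \<equiv> INF K\<in>S\<^sub>0. infdist K (frontier S)"
  assumes b: "0 < b" and S0: "S\<^sub>0 \<noteq> {}" and l: "0 < l" "lipschitz_on l S cost"
  shows "0 < d" and "\<And>K. K \<in> S\<^sub>0 \<Longrightarrow> ball K d \<subseteq> interior S"
proof -
  have sub: "S\<^sub>0 \<subseteq> S" unfolding S\<^sub>0_def S_def using b by auto
  have closed: "closed S" and bounded: "bounded S"
    unfolding S_def by (rule closed_sublevel, rule bounded_sublevel)
  have "S \<noteq> UNIV" using bounded not_bounded_UNIV by metis
  then have front: "frontier S \<noteq> {}" using S0 sub frontier_not_empty by blast
  have far: "b / l \<le> dist K P" if K: "K \<in> S\<^sub>0" and P: "P \<in> frontier S" for K P
  proof (rule ccontr)
    assume "\<not> b / l \<le> dist K P"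
    then have "dist K P < b / l" by simp
    then have "dist K P * l < b" using l(1) by (simp only: pos_less_divide_eq)
    then have "l * dist P K < b" by (simp add: dist_commute mult.commute)
    moreover have PS: "P \<in> S" using P frontier_subset_closed[OF closed] by blast
    then have "dist (cost P) (cost K) \<le> l * dist P K" using lipschitz_onD[OF l(2)] K sub by blast
    ultimately have "cost P < 2 * b"
      using K by (simp add: S\<^sub>0_def dist_real_def abs_le_iff)
    then have "P \<in> {K \<in> stab. cost K < 2 * b}" using PS by (simp add: S_def)
    moreover have "{K \<in> stab. cost K < 2 * b} \<subseteq> S" by (auto simp: S_def)
    ultimately have "P \<in> interior S" using open_strict_sublevel by (rule_tac interiorI)
    then show False using P by (simp add: frontier_def)
  qed
  have "b / l \<le> d"
    unfolding d_def
  proof (rule cINF_greatest[OF S0])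
    fix K assume "K \<in> S\<^sub>0"
    then show "b / l \<le> infdist K (frontier S)"
      using front far by (simp add: infdist_notempty) (rule cINF_greatest, auto)
  qed
  moreover have "0 < b / l" using b l by simp
  ultimately show "0 < d" by linarith
  show "ball K d \<subseteq> interior S" if K: "K \<in> S\<^sub>0" for K
  proof (rule interior_maximal)
    have "d \<le> infdist K (frontier S)"
      unfolding d_def using K by (intro cINF_lower bdd_belowI[of _ 0]) (auto simp: infdist_nonneg)
    then have "d \<le> dist K P" if "P \<in> frontier S" for P
      using infdist_le[OF that, of K] by linarith
    then have "ball K d \<inter> frontier S = {}" by force
    moreover have "K \<in> ball K d \<inter> S" using K sub \<open>0 < d\<close> by auto
    ultimately show "ball K d \<subseteq> S" using connected_Int_frontier[OF connected_ball] by blast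
  qed simp
qed


theorem theorem3:
  fixes A :: "real^'nx^'nx" and B :: "real^'nu^'nx" and Bw :: "real^'nw^'nx"
    and C :: "real^'nx^'ny" and Q :: "real^'nx^'nx" and R :: "real^'nu^'nu"
    and K0 :: "real^'ny^'nu" and J :: "real^'ny^'nu \<Rightarrow> real"
    and \<K> \<K>\<^sub>0 \<K>\<^sub>1 :: "(real^'ny^'nu) set"
    and m l d \<beta> \<rho> :: real
  assumes stab: "stabilizable A B"
    and rank_Bw: "rank Bw = CARD('nx)" and rank_C: "rank C = CARD('ny)"
    and Q: "pos_def Q" and R: "pos_def R"
    and K_def: "\<K> = stabilizing_gains A B C" and K_ne: "\<K> \<noteq> {}"
    and J_def: "J = hinf_cost A B Bw C Q R"
    and K0: "K0 \<in> \<K>" and K0_subopt: "J K0 > (INF K\<in>\<K>. J K)"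
    and sub0_def: "\<K>\<^sub>0 = {K \<in> \<K>. J K \<le> J K0}"
    and sub1_def: "\<K>\<^sub>1 = {K \<in> \<K>. J K \<le> 2 * J K0}"
    and m: "m > 0" "\<And>U. U \<subseteq> \<K>\<^sub>1 \<Longrightarrow> convex U \<Longrightarrow> weakly_convex_on m U J"
    and l: "l > 0" "lipschitz_on l \<K>\<^sub>1 J"
    and d_def: "d = (INF K\<in>\<K>\<^sub>0. infdist K (frontier \<K>\<^sub>1))"
    and beta: "0 < \<beta>" "\<beta> < 1"
  shows "\<exists>c>0. \<forall>mt l\<^sub>M.
           0 \<le> l\<^sub>M \<and> (mt \<noteq> General \<longrightarrow> l\<^sub>M = 0) \<and>
           \<rho> > max (l / d + m) (max (l\<^sub>M / d) (2 * l / d - m)) \<longrightarrow>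
           (\<forall>T K n L G M. bundle_execution mt J m l\<^sub>M \<K>\<^sub>1 \<beta> \<rho> K0 T K n L G M \<longrightarrow>
              (\<forall>t\<le>T. K t \<in> \<K>\<^sub>0) \<and>
              (\<forall>t\<le>T. \<forall>k\<le>n t. L t k \<in> interior \<K>\<^sub>1) \<and>
              (\<forall>\<eta> \<epsilon>. 0 < \<eta> \<and> \<eta> \<le> 1 \<and> 0 < \<epsilon> \<and> \<epsilon> \<le> 1 \<and>
                 real (\<Sum>t\<le>T. n t) \<ge> c * max (1 / \<eta> ^ 4) (1 / \<epsilon>\<^sup>2) \<longrightarrow>
                 (\<exists>t\<le>T. stationary_point J m \<K>\<^sub>1 \<eta> \<epsilon> (K t))))"
proof -
  interpret hinf: hinf_problem A B Bw C Q R
    by unfold_locales (use rank_Bw rank_C Q R in auto)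
  have sub0: "\<K>\<^sub>0 = {K \<in> stabilizing_gains A B C. hinf_cost A B Bw C Q R K \<le> J K0}"
    and sub1: "\<K>\<^sub>1 = {K \<in> stabilizing_gains A B C. hinf_cost A B Bw C Q R K \<le> 2 * J K0}"
    using sub0_def sub1_def K_def J_def by simp_all
  have nonneg: "0 \<le> J K" if "K \<in> \<K>" for K
    using hinf.cost_nonneg that by (simp add: K_def J_def)
  have "0 \<le> (INF K\<in>\<K>. J K)" by (rule cINF_greatest[OF K_ne nonneg])
  then have pos: "0 < J K0" using K0_subopt by linarith
  have "\<K>\<^sub>0 \<noteq> {}" using K0 sub0_def by auto
  then have margin: "0 < d" "\<And>K. K \<in> \<K>\<^sub>0 \<Longrightarrow> ball K d \<subseteq> interior \<K>\<^sub>1"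
    using hinf.sublevel_margin[OF pos _ l(1)] l(2) by (simp_all add: d_def sub0 sub1 J_def)
  show ?thesis
  proof (cases "l / d + m < \<rho>")
    case False
    \<comment> \<open>No admissible \<open>\<rho>\<close>, so any constant works.\<close>
    then show ?thesis by (intro exI[of _ 1]) auto
  next
    case True
    have rho: "l + m * d < \<rho> * d"
      using mult_strict_right_mono[OF True margin(1)] margin(1) by (simp add: algebra_simps)
    interpret descent: bundle_method J m l d \<rho> \<beta> "J K0" \<K>\<^sub>1
      by unfold_locales (use m l beta margin rho nonneg in \<open>auto simp: sub0_def sub1_def\<close>)
    have K0': "K0 \<in> \<K>\<^sub>1" "J K0 \<le> J K0" using K0 pos by (auto simp: sub1_def)
    have "0 < l / d" using l margin by simp
    then have "0 < \<rho>" using True m by linarith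
    then have "0 < descent.rate" using pos by (intro descent.rate_pos) auto
    moreover have "(\<forall>t\<le>T. K t \<in> \<K>\<^sub>0) \<and> (\<forall>t\<le>T. \<forall>k\<le>n t. L t k \<in> interior \<K>\<^sub>1) \<and>
        (\<forall>\<eta> \<epsilon>. 0 < \<eta> \<and> \<eta> \<le> 1 \<and> 0 < \<epsilon> \<and> \<epsilon> \<le> 1 \<and>
           real (\<Sum>t\<le>T. n t) \<ge> descent.rate * max (1 / \<eta> ^ 4) (1 / \<epsilon>\<^sup>2) \<longrightarrow>
           (\<exists>t\<le>T. stationary_point J m \<K>\<^sub>1 \<eta> \<epsilon> (K t)))"
      if rho_max: "max (l / d + m) (max (l\<^sub>M / d) (2 * l / d - m)) < \<rho>"
        and exec: "bundle_execution mt J m l\<^sub>M \<K>\<^sub>1 \<beta> \<rho> K0 T K n L G M"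
      for mt l\<^sub>M T K n L G M
    proof -
      have "l\<^sub>M / d < \<rho>" using rho_max by simp
      then have lM: "l\<^sub>M < \<rho> * d" using margin(1) by (simp add: pos_divide_less_eq)
      have "K t \<in> \<K>\<^sub>0" if "t \<le> T" for t
        using descent.outer_iterate_in_sublevel[OF exec lM K0' that] by (auto simp: sub0_def sub1_def)
      then show ?thesis
        using descent.inner_iterate_in_interior[OF exec lM K0']
          descent.stationary_point_reached[OF exec lM K0'] by blast
    qed
    ultimately show ?thesis by (intro exI[of _ descent.rate]) blast
  qed
qed

end
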